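(* For each $n$ let $\bar\gamma_n$ be a lazy walk on $\{0,\dots,n\}$ with $\bar\gamma_n(0)=0$ minimizing $A(B,F;\gamma)$ among all lazy walks of length $n$ started at $0$ (free endpoint), and set \[ \ell_n=\operatorname{argmin}_{x\in\operatorname{range}(\bar\gamma_n)}d(x),\quad d_n=d(\ell_n),\quad \tau_n=\min\{i:\bar\gamma_n(i)\in\{\ell_n,\ell_n+1\}\}. \] Then with probability tending to $1$ as $n\to\infty$, $\bar\gamma_n(i)\in\{\ell_n,\ell_n+1\}$ for all $i\ge\tau_n$. Moreover, for every $\varepsilon>0$ there are $0<k_1<k_2$ such that for all sufficiently large $n$, \[ \mathbb P(k_1n^{\zeta}\le|\ell_n|\le k_2n^{\zeta})\ge1-\varepsilon,\quad \mathbb P(k_1n^{\zeta-1}\le d_n\le k_2n^{\zeta-1})\ge1-\varepsilon, \] \[ \mathbb P\big(k_1n^{\zeta}\le cn+A(B,F;\bar\gamma_n)\le k_2n^{\zeta}\big)\ge1-\varepsilon. \]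
   Context: Let $c>0$, $q>0$, $\kappa>-1$. $F=(F(x))_{x\in\mathbb Z}$ and $B=(B(i))_{i\in\mathbb Z}$ are mutually independent families of i.i.d. random variables, $\mathbb P(B(i)=\pm1)=1/2$, and $F(x)$ has a density $\varrho$ that is even, continuous, strictly positive on $(-c,c)$, zero outside $(-c,c)$, with $\lim_{x\to c}\varrho(x)/|c-x|^{\kappa}=q$. A lazy walk of length $n$ is $\gamma:\{0,\dots,n\}\to\mathbb Z$ with $|\gamma(i+1)-\gamma(i)|\le1$; its action is $A(B,F;\gamma)=\sum_{i=1}^nB(i)F(\gamma(i))$. The discrepancy of the edge $\{x,x+1\}$ is $d(x)=2c-|F(x+1)-F(x)|$. Let $\zeta=\frac{2\kappa+2}{2\kappa+3}$. *)

theory Defs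
  imports "HOL-Probability.Probability"
begin

text \<open>A lazy walk of length n: a map on {0..n} (values beyond n are irrelevant)
  with steps of size at most 1.\<close>
definition lazy_walk :: "nat \<Rightarrow> (nat \<Rightarrow> int) \<Rightarrow> bool" where
  "lazy_walk n \<gamma> \<longleftrightarrow> (\<forall>i<n. \<bar>\<gamma> (Suc i) - \<gamma> i\<bar> \<le> 1)"

definition action :: "(int \<Rightarrow> real) \<Rightarrow> (int \<Rightarrow> real) \<Rightarrow> nat \<Rightarrow> (nat \<Rightarrow> int) \<Rightarrow> real" where
  "action B F n \<gamma> = (\<Sum>i=1..n. B (int i) * F (\<gamma> i))"

definition optimal_walk :: "(int \<Rightarrow> real) \<Rightarrow> (int \<Rightarrow> real) \<Rightarrow> nat \<Rightarrow> (nat \<Rightarrow> int) \<Rightarrow> bool" where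
  "optimal_walk B F n \<gamma> \<longleftrightarrow> lazy_walk n \<gamma> \<and> \<gamma> 0 = 0 \<and>
     (\<forall>\<gamma>'. lazy_walk n \<gamma>' \<and> \<gamma>' 0 = 0 \<longrightarrow> action B F n \<gamma> \<le> action B F n \<gamma>')"

definition discrepancy :: "real \<Rightarrow> (int \<Rightarrow> real) \<Rightarrow> int \<Rightarrow> real" where
  "discrepancy c F x = 2 * c - \<bar>F (x + 1) - F x\<bar>"

definition hit_time :: "(nat \<Rightarrow> int) \<Rightarrow> int \<Rightarrow> nat" where
  "hit_time \<gamma> l = (LEAST i. \<gamma> i \<in> {l, l + 1})"

text \<open>Inner (lower) probability of an arbitrary, possibly non-measurable, set;
  coincides with the probability on events.\<close>
definition lprob :: "'a measure \<Rightarrow> 'a set \<Rightarrow> real" where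
  "lprob M A = (SUP E \<in> {E \<in> sets M. E \<subseteq> A}. measure M E)"

end

theory Submission
  imports Defs "HOL-Real_Asymp.Real_Asymp"
begin

text \<open>
  Write \<open>d\<close> for the discrepancy. Alternating on the edge \<open>{x, x + 1}\<close> costs
  \<open>d x / 2 + B i * (F x + F (x + 1)) / 2\<close> above the ideal value \<open>- c\<close> in step \<open>i\<close>, and
  \<open>\<bar>F x + F (x + 1)\<bar> \<le> d x\<close>. The smallest discrepancy among \<open>n powr \<zeta>\<close> edges is of order
  \<open>\<delta> = n powr (\<zeta> - 1)\<close>, so walking to the best one gives a total cost of order \<open>\<delta> * n = n powr \<zeta>\<close>.
  Conversely, a positive fraction of the sites stays away from \<open>\<plusminus>c\<close> and every visit there has
  a cost bounded below, so the range has order at most \<open>n powr \<zeta>\<close>.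

  For the sharp lower bound on the cost, call a site high if \<open>c - \<bar>F x\<bar>\<close> is below a threshold slightly larger
  than \<open>\<delta>\<close>. With high probability no three consecutive sites are high, so between two
  visits to non-high sites the walk is confined to a single edge. Cutting the walk at the non-high sites
  shows that \<open>m\<close> steps along edges of discrepancy at least \<open>D\<close> cost about \<open>D * m / 2\<close>: the
  fluctuations of the partial sums of \<open>B\<close> are absorbed by the cost of the cuts.

  With high probability every other edge in range has discrepancy at least \<open>d l + \<eta> * \<delta>\<close>, where
  \<open>l\<close> is the minimizer. An excursion away from \<open>{l, l + 1}\<close> starts at a non-high site and would
  therefore be strictly more expensive than alternating on \<open>{l, l + 1}\<close> during the same time.
\<close>

section \<open>Walks in a fixed environment\<close>

definition step_cost :: "real \<Rightarrow> (int \<Rightarrow> real) \<Rightarrow> (int \<Rightarrow> real) \<Rightarrow> (nat \<Rightarrow> int) \<Rightarrow> nat \<Rightarrow> real" where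
  "step_cost c b f \<gamma> i = c + b (int i) * f (\<gamma> i)"

text \<open>The greedy choice on an edge needs no look-ahead: its endpoints are one lazy step apart,
  so a walk on the edge may follow it freely.\<close>

definition edge_opt :: "(int \<Rightarrow> real) \<Rightarrow> (int \<Rightarrow> real) \<Rightarrow> int \<Rightarrow> nat \<Rightarrow> int" where
  "edge_opt b f x i = (if b (int i) * f x \<le> b (int i) * f (x + 1) then x else x + 1)"

lemma sum_step_cost: "(\<Sum>i=1..<Suc n. step_cost c b f \<gamma> i) = c * real n + action b f n \<gamma>"
  by (simp add: step_cost_def action_def sum.distrib atLeastLessThanSuc_atLeastAtMost)

text \<open>Keeps only properties that hold for almost every realization; the whole comparison of
  walks is then deterministic.\<close>

locale bounded_potential =
  fixes c :: real and b f :: "int \<Rightarrow> real"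
  assumes c_pos: "0 < c"
    and f_bound: "\<And>x. \<bar>f x\<bar> \<le> c"
    and b_sign: "\<And>i. b i = 1 \<or> b i = -1"
begin

abbreviation "cost \<equiv> step_cost c b f"
abbreviation "disc \<equiv> discrepancy c f"

lemma cost_ge_gap: "c - \<bar>f (\<gamma> i)\<bar> \<le> cost \<gamma> i"
  using b_sign[of "int i"] by (auto simp: step_cost_def)

lemma cost_nonneg: "0 \<le> cost \<gamma> i"
  using cost_ge_gap[of \<gamma> i] f_bound[of "\<gamma> i"] by simp

lemma cost_le: "cost \<gamma> i \<le> 2 * c"
  using b_sign[of "int i"] f_bound[of "\<gamma> i"] by (auto simp: step_cost_def)

text \<open>For reals p and r, |p + r| + |p - r| is twice the larger absolute value, here at most
  \<open>2 * c\<close>. Thus the noise on an edge never exceeds the scale of its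
  discrepancy.\<close>

lemma edge_sum_le_disc: "\<bar>f x + f (x + 1)\<bar> \<le> disc x"
  using f_bound[of x] f_bound[of "x + 1"] by (simp add: discrepancy_def)

lemma disc_nonneg: "0 \<le> disc x"
  using edge_sum_le_disc[of x] by linarith

text \<open>The minimum of two numbers is half their sum minus half their distance; the sign
  \<open>b\<close> affects only the sum.\<close>

lemma edge_opt_cost:
  assumes "\<gamma> i = edge_opt b f x i"
  shows "cost \<gamma> i = disc x / 2 + b (int i) * ((f x + f (x + 1)) / 2)"
  using b_sign[of "int i"] assms
  by (auto simp: step_cost_def edge_opt_def discrepancy_def abs_if field_simps split: if_splits)

lemma edge_cost_ge:
  assumes "\<gamma> i \<in> {x, x + 1}"
  shows "disc x / 2 + b (int i) * ((f x + f (x + 1)) / 2) \<le> cost \<gamma> i"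
  using b_sign[of "int i"] assms
  by (auto simp: step_cost_def discrepancy_def abs_if field_simps split: if_splits)

lemma edge_opt_cost_le_disc:
  assumes "\<gamma> i = edge_opt b f x i"
  shows "cost \<gamma> i \<le> disc x"
  using edge_opt_cost[of \<gamma> i x, OF assms] edge_sum_le_disc[of x] b_sign[of "int i"]
  by (auto simp: abs_le_iff field_simps)

lemma abs_sum_signs_le: "\<bar>\<Sum>i=s..<t. b (int i)\<bar> \<le> real (t - s)"
proof -
  have "\<bar>\<Sum>i=s..<t. b (int i)\<bar> \<le> (\<Sum>i=s..<t. \<bar>b (int i)\<bar>)" by (rule sum_abs)
  also have "\<dots> = (\<Sum>i=s..<t. 1)"
    by (rule sum.cong) (use b_sign in \<open>metis abs_1 abs_minus_cancel\<close>)+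
  finally show ?thesis by simp
qed

section \<open>Upper bound on the optimal cost and control of the range\<close>

text \<open>The competitor walks straight to \<open>x\<close> and then plays greedily on the edge
  \<open>{x, x + 1}\<close>; each step of the approach is charged the maximal cost
  \<open>2 * c\<close>.\<close>

lemma optimal_cost_le:
  assumes opt: "optimal_walk b f n \<gamma>" and x: "x \<le> n"
  shows "(\<Sum>i=1..<Suc n. cost \<gamma> i) \<le> 2 * c * real x + disc (int x) * real n"
proof -
  define \<gamma>' where "\<gamma>' i = (if i \<le> x then int i else edge_opt b f (int x) i)" for i
  have "lazy_walk n \<gamma>'"
    by (auto simp: lazy_walk_def \<gamma>'_def edge_opt_def)
  moreover have "\<gamma>' 0 = 0" by (simp add: \<gamma>'_def)
  ultimately have "action b f n \<gamma> \<le> action b f n \<gamma>'"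
    using opt by (auto simp: optimal_walk_def)
  then have "(\<Sum>i=1..<Suc n. cost \<gamma> i) \<le> (\<Sum>i=1..<Suc n. cost \<gamma>' i)"
    by (simp only: sum_step_cost)
  also have "\<dots> = (\<Sum>i=1..<Suc x. cost \<gamma>' i) + (\<Sum>i=Suc x..<Suc n. cost \<gamma>' i)"
    using x by (subst sum.atLeastLessThan_concat) auto
  also have "\<dots> \<le> (\<Sum>i=1..<Suc x. 2 * c) + (\<Sum>i=Suc x..<Suc n. disc (int x))"
    by (intro add_mono sum_mono cost_le edge_opt_cost_le_disc) (auto simp: \<gamma>'_def)
  also have "\<dots> \<le> 2 * c * real x + disc (int x) * real n"
    using x disc_nonneg[of "int x"] by (simp add: algebra_simps)
  finally show ?thesis .
qed

text \<open>A discrete intermediate value argument, by induction on \<open>t\<close>. Excluding site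
  0 yields a visit at a time at least 1, where costs start to count.\<close>

lemma lazy_walk_visits:
  assumes lazy: "lazy_walk n \<gamma>" and "\<gamma> 0 = 0" and t: "t \<le> n"
    and x: "0 < x \<and> x \<le> \<gamma> t \<or> \<gamma> t \<le> x \<and> x < 0"
  shows "\<exists>i\<in>{1..<Suc n}. \<gamma> i = x"
  using t x
proof (induction t)
  case 0
  then show ?case using \<open>\<gamma> 0 = 0\<close> by auto
next
  case (Suc t)
  have st: "\<bar>\<gamma> (Suc t) - \<gamma> t\<bar> \<le> 1"
    using lazy Suc.prems by (auto simp: lazy_walk_def)
  show ?case
  proof (cases "\<gamma> (Suc t) = x")
    case True
    then show ?thesis using Suc.prems by auto
  next
    case False
    then show ?thesis using Suc st by force
  qed
qed

text \<open>A walk reaching distance \<open>R\<close> crosses all sites on one side, and at least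
  half of them cost \<open>c - \<theta>\<close> per visit. Both sides are assumed because the
  direction is not known in advance.\<close>

lemma range_cost_ge:
  assumes lazy: "lazy_walk n \<gamma>" and g0: "\<gamma> 0 = 0" and t: "t \<le> n"
    and far: "int R \<le> \<bar>\<gamma> t\<bar>"
    and right: "real R / 2 \<le> real (card {x\<in>{1..int R}. \<bar>f x\<bar> \<le> \<theta>})"
    and left: "real R / 2 \<le> real (card {x\<in>{- int R..-1}. \<bar>f x\<bar> \<le> \<theta>})"
    and th: "\<theta> \<le> c"
  shows "(c - \<theta>) * (real R / 2) \<le> (\<Sum>i=1..<Suc n. cost \<gamma> i)"
proof -
  have main: ?thesis
    if X: "X = {x\<in>Y. \<bar>f x\<bar> \<le> \<theta>}" and cX: "real R / 2 \<le> real (card X)"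
      and Y: "finite Y" "\<And>x. x \<in> Y \<Longrightarrow> 0 < x \<and> x \<le> \<gamma> t \<or> \<gamma> t \<le> x \<and> x < 0" for X Y
  proof -
    have "\<forall>x\<in>X. \<exists>i\<in>{1..<Suc n}. \<gamma> i = x"
      using lazy_walk_visits[OF lazy g0 t] Y X by blast
    \<comment> \<open>One visit time is picked for each low site; distinct sites have distinct
      times, so their costs add up.\<close>
    then obtain T where T: "\<And>x. x \<in> X \<Longrightarrow> T x \<in> {1..<Suc n} \<and> \<gamma> (T x) = x"
      by metis
    have inj: "inj_on T X" by (rule inj_onI) (metis T)
    have "(c - \<theta>) * (real R / 2) \<le> (c - \<theta>) * real (card X)"
      using th cX by (intro mult_left_mono) auto
    also have "\<dots> = (\<Sum>x\<in>X. c - \<theta>)" by simp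
    also have "\<dots> \<le> (\<Sum>x\<in>X. cost \<gamma> (T x))"
    proof (rule sum_mono)
      fix x assume "x \<in> X"
      then show "c - \<theta> \<le> cost \<gamma> (T x)"
        using cost_ge_gap[of \<gamma> "T x"] T[of x] X by auto
    qed
    also have "\<dots> = (\<Sum>i\<in>T ` X. cost \<gamma> i)"
      using inj by (simp add: sum.reindex)
    also have "\<dots> \<le> (\<Sum>i=1..<Suc n. cost \<gamma> i)"
      using T by (intro sum_mono2 cost_nonneg) auto
    finally show ?thesis .
  qed
  show ?thesis
  proof (cases "0 \<le> \<gamma> t")
    case True
    show ?thesis by (rule main[OF refl right]) (use True far in auto)
  next
    case False
    show ?thesis by (rule main[OF refl left]) (use False far in auto)
  qed
qed

section \<open>Lower bound on the cost by cutting at non-high sites\<close>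

text \<open>The noise contributes \<open>g / 2\<close> times a sum of signs, and \<open>g\<close> is
  dominated by \<open>e\<close>. The pair \<open>e\<close>, \<open>g\<close> stands for an edge (its
  discrepancy and the sum of its values) or for a single site (\<open>2 * c\<close> and
  \<open>2 * f x\<close>).\<close>

lemma run_cost_ge:
  assumes pos: "\<And>i. i \<in> {s..<t} \<Longrightarrow> e / 2 + b (int i) * (g / 2) \<le> cost \<gamma> i"
    and g: "\<bar>g\<bar> \<le> e" and D: "0 \<le> D" "D \<le> e" and st: "s \<le> t"
    and S: "\<bar>\<Sum>i=s..<t. b (int i)\<bar> \<le> \<epsilon> * real (t - s) + C"
  shows "D / 2 * ((1 - \<epsilon>) * real (t - s) - C) \<le> (\<Sum>i=s..<t. cost \<gamma> i)"
proof -
  define S where "S = (\<Sum>i=s..<t. b (int i))"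
  have "D / 2 * ((1 - \<epsilon>) * real (t - s) - C) \<le> D / 2 * (real (t - s) - \<bar>S\<bar>)"
    using S D by (intro mult_left_mono) (auto simp: S_def algebra_simps)
  \<comment> \<open>The common factor is nonnegative because a sum of signs is at most the number of
    its terms.\<close>
  also have "\<dots> \<le> e / 2 * (real (t - s) - \<bar>S\<bar>)"
    using D abs_sum_signs_le[of s t] by (intro mult_right_mono) (auto simp: S_def)
  also have "\<dots> \<le> e / 2 * real (t - s) + S * (g / 2)"
  proof -
    have "\<bar>S * g\<bar> \<le> \<bar>S\<bar> * e" using g by (simp add: abs_mult mult_left_mono)
    then show ?thesis by (simp add: algebra_simps)
  qed
  also have "\<dots> = (\<Sum>i=s..<t. e / 2 + b (int i) * (g / 2))"
    by (simp only: sum.distrib S_def sum_distrib_right) simp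
  also have "\<dots> \<le> (\<Sum>i=s..<t. cost \<gamma> i)"
    by (rule sum_mono) (rule pos)
  finally show ?thesis .
qed

text \<open>Without three consecutive high sites, the start has a high neighbour on at most one
  side, and the site beyond that neighbour is not high. The conclusion separates one site from an
  edge with both endpoints visited, since only for such edges will a discrepancy bound be
  available.\<close>

lemma confined_to_edge:
  fixes G :: "int \<Rightarrow> bool"
  assumes st: "s < t"
    and lazy: "\<And>i. s \<le> i \<Longrightarrow> Suc i < t \<Longrightarrow> \<bar>\<gamma> (Suc i) - \<gamma> i\<bar> \<le> 1"
    and G: "\<And>i. i \<in> {s..<t} \<Longrightarrow> G (\<gamma> i)"
    and R: "\<And>i. i \<in> {s..<t} \<Longrightarrow> \<bar>\<gamma> i\<bar> \<le> R"
    and tri: "\<And>p. \<bar>p\<bar> \<le> R + 1 \<Longrightarrow> \<not> (G (p - 1) \<and> G p \<and> G (p + 1))"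
  shows "\<exists>x. (\<forall>i\<in>{s..<t}. \<gamma> i = x) \<or>
     ((\<forall>i\<in>{s..<t}. \<gamma> i \<in> {x, x + 1}) \<and> x \<in> \<gamma> ` {s..<t} \<and> x + 1 \<in> \<gamma> ` {s..<t})"
proof -
  define p where "p = \<gamma> s"
  have p: "G p" "\<bar>p\<bar> \<le> R" using G[of s] R[of s] st by (auto simp: p_def)
  \<comment> \<open>Invariance principle: a set containing the start and closed under lazy moves to
    high sites contains the whole run.\<close>
  have stay: "\<forall>i\<in>{s..<t}. \<gamma> i \<in> Q"
    if pQ: "p \<in> Q" and Q: "\<And>y z. y \<in> Q \<Longrightarrow> \<bar>z - y\<bar> \<le> 1 \<Longrightarrow> G z \<Longrightarrow> z \<in> Q" for Q
  proof
    fix i assume "i \<in> {s..<t}"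
    then have "s \<le> i" "i < t" by auto
    then show "\<gamma> i \<in> Q"
    proof (induction i rule: dec_induct)
      case base
      then show ?case using pQ by (simp add: p_def)
    next
      case (step i)
      then show ?case using Q[of "\<gamma> i" "\<gamma> (Suc i)"] lazy[of i] G[of "Suc i"] by auto
    qed
  qed
  have fin: ?thesis if "\<forall>i\<in>{s..<t}. \<gamma> i \<in> {x, x + 1}" for x
    using that by (metis (no_types, lifting) image_iff insertE singletonD)
  have adj: "\<bar>z - y\<bar> \<le> 1 \<Longrightarrow> z = y - 1 \<or> z = y \<or> z = y + 1" for y z :: int by auto
  have t1: "\<not> (G (p - 1) \<and> G (p + 1))" using tri[of p] p by auto
  \<comment> \<open>This triple and the next one are centred next to \<open>p\<close>, hence the
    window \<open>R + 1\<close> in \<open>tri\<close>.\<close>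
  have t2: "\<not> (G (p + 1) \<and> G (p + 2))" using tri[of "p + 1"] p by (auto simp: add.commute)
  have t3: "\<not> (G (p - 1) \<and> G (p - 2))" using tri[of "p - 1"] p by force
  consider "G (p + 1)" | "G (p - 1)" | "\<not> G (p + 1)" "\<not> G (p - 1)" by blast
  then show ?thesis
  proof cases
    case 1
    have "\<forall>i\<in>{s..<t}. \<gamma> i \<in> {p, p + 1}"
      by (rule stay) (use 1 t1 t2 in \<open>auto dest!: adj simp: algebra_simps\<close>)
    then show ?thesis by (rule fin)
  next
    case 2
    have "\<forall>i\<in>{s..<t}. \<gamma> i \<in> {p - 1, p - 1 + 1}"
      by (rule stay) (use 2 t1 t3 in \<open>auto dest!: adj simp: algebra_simps\<close>)
    then show ?thesis by (rule fin)
  next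
    case 3
    have "\<forall>i\<in>{s..<t}. \<gamma> i \<in> {p}"
      by (rule stay) (use 3 in \<open>auto dest!: adj\<close>)
    then show ?thesis by auto
  qed
qed

text \<open>Induction on the length of the time interval, cutting at the first visit to a non-high
  site. A cut turns one allowance \<open>C\<close> into two; its cost, at least \<open>h\<close>,
  repays the additional allowance and the step itself.\<close>

lemma walk_cost_ge:
  assumes st: "s \<le> t"
    and lazy: "\<And>i. s \<le> i \<Longrightarrow> Suc i < t \<Longrightarrow> \<bar>\<gamma> (Suc i) - \<gamma> i\<bar> \<le> 1"
    and R: "\<And>i. i \<in> {s..<t} \<Longrightarrow> \<bar>\<gamma> i\<bar> \<le> R"
    and tri: "\<And>p. \<bar>p\<bar> \<le> R + 1 \<Longrightarrow>
        \<not> (c - h < \<bar>f (p - 1)\<bar> \<and> c - h < \<bar>f p\<bar> \<and> c - h < \<bar>f (p + 1)\<bar>)"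
    and S: "\<And>u v. s \<le> u \<Longrightarrow> u \<le> v \<Longrightarrow> v \<le> t \<Longrightarrow>
        \<bar>\<Sum>i=u..<v. b (int i)\<bar> \<le> \<epsilon> * real (v - u) + C"
    and edges: "\<And>p. p \<in> \<gamma> ` {s..<t} \<Longrightarrow> p + 1 \<in> \<gamma> ` {s..<t} \<Longrightarrow> D \<le> disc p"
    and D: "0 \<le> D" "D \<le> 2 * c" and C: "0 \<le> C" and eps: "0 \<le> \<epsilon>"
    and h: "D / 2 * (C + 1) \<le> h"
  shows "D / 2 * ((1 - \<epsilon>) * real (t - s) - C) \<le> (\<Sum>i=s..<t. cost \<gamma> i)"
  using st lazy R S edges
proof (induction "t - s" arbitrary: s rule: less_induct)
  case less
  define G where "G x \<longleftrightarrow> c - h < \<bar>f x\<bar>" for x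
  have triG: "\<not> (G (p - 1) \<and> G p \<and> G (p + 1))" if "\<bar>p\<bar> \<le> R + 1" for p
    using tri[OF that] by (simp add: G_def)
  have run: "D / 2 * ((1 - \<epsilon>) * real (u - s) - C) \<le> (\<Sum>i=s..<u. cost \<gamma> i)"
    if u: "s \<le> u" "u \<le> t" and Gu: "\<And>i. i \<in> {s..<u} \<Longrightarrow> G (\<gamma> i)" for u
  proof (cases "s = u")
    case True
    then show ?thesis using D C by simp
  next
    case False
    then have su: "s < u" using u by simp
    have Su: "\<bar>\<Sum>i=s..<u. b (int i)\<bar> \<le> \<epsilon> * real (u - s) + C"
      using less.prems(4)[of s u] u by auto
    have "\<exists>x. (\<forall>i\<in>{s..<u}. \<gamma> i = x) \<or>
     ((\<forall>i\<in>{s..<u}. \<gamma> i \<in> {x, x + 1}) \<and> x \<in> \<gamma> ` {s..<u} \<and> x + 1 \<in> \<gamma> ` {s..<u})"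
      by (rule confined_to_edge[OF su, where G = G and R = R])
         (use less.prems u Gu triG in auto)
    then obtain x where
      "(\<forall>i\<in>{s..<u}. \<gamma> i = x) \<or>
       ((\<forall>i\<in>{s..<u}. \<gamma> i \<in> {x, x + 1}) \<and> x \<in> \<gamma> ` {s..<u} \<and> x + 1 \<in> \<gamma> ` {s..<u})" by blast
    then show ?thesis
    proof
      assume x: "\<forall>i\<in>{s..<u}. \<gamma> i = x"
      \<comment> \<open>A constant run has no edge to bound; \<open>D \<le> 2 * c\<close> takes the
        place of the discrepancy bound.\<close>
      show ?thesis
        by (rule run_cost_ge[where e = "2 * c" and g = "2 * f x"])
           (use x D Su u f_bound[of x] in \<open>auto simp: step_cost_def\<close>)
    next
      assume x: "(\<forall>i\<in>{s..<u}. \<gamma> i \<in> {x, x + 1}) \<and> x \<in> \<gamma> ` {s..<u} \<and> x + 1 \<in> \<gamma> ` {s..<u}"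
      have "\<gamma> ` {s..<u} \<subseteq> \<gamma> ` {s..<t}" using u by auto
      then have "D \<le> disc x" using less.prems(5)[of x] x by blast
      then show ?thesis
        by (intro run_cost_ge[where e = "disc x" and g = "f x + f (x + 1)"])
           (use x D Su u edge_sum_le_disc[of x] edge_cost_ge in auto)
    qed
  qed
  show ?case
  proof (cases "\<forall>i\<in>{s..<t}. G (\<gamma> i)")
    case True
    then show ?thesis using run[of t] less.prems(1) by auto
  next
    case False
    define P where "P = (\<lambda>i. i \<in> {s..<t} \<and> \<not> G (\<gamma> i))"
    define u where "u = (LEAST i. P i)"
    have "\<exists>i. P i" using False by (auto simp: P_def)
    then have "P u" unfolding u_def by (rule LeastI_ex)
    moreover have "\<not> P i" if "i < u" for i using that not_less_Least unfolding u_def by blast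
    ultimately have u: "s \<le> u" "u < t" "\<not> G (\<gamma> u)" "\<And>i. i \<in> {s..<u} \<Longrightarrow> G (\<gamma> i)"
      by (auto simp: P_def)
    have 1: "D / 2 * ((1 - \<epsilon>) * real (u - s) - C) \<le> (\<Sum>i=s..<u. cost \<gamma> i)"
      using run[of u] u by auto
    have 2: "h \<le> cost \<gamma> u"
      using cost_ge_gap[of \<gamma> u] u(3) by (simp add: G_def)
    have 3: "D / 2 * ((1 - \<epsilon>) * real (t - Suc u) - C) \<le> (\<Sum>i=Suc u..<t. cost \<gamma> i)"
    proof (rule less.hyps)
      have "\<gamma> ` {Suc u..<t} \<subseteq> \<gamma> ` {s..<t}" using u by auto
      then show "D \<le> disc p" if "p \<in> \<gamma> ` {Suc u..<t}" "p + 1 \<in> \<gamma> ` {Suc u..<t}" for p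
        using that less.prems(5)[of p] by blast
    qed (use u less.prems in auto)
    have "(\<Sum>i=s..<t. cost \<gamma> i) = (\<Sum>i=s..<u. cost \<gamma> i) + (cost \<gamma> u + (\<Sum>i=Suc u..<t. cost \<gamma> i))"
      using u by (simp add: sum.atLeast_Suc_lessThan[symmetric] sum.atLeastLessThan_concat)
    moreover have m: "real (t - s) = real (u - s) + 1 + real (t - Suc u)" using u by simp
    have "D / 2 * ((1 - \<epsilon>) * real (t - s) - C) =
       D / 2 * ((1 - \<epsilon>) * real (u - s) - C) + D / 2 * ((1 - \<epsilon>) * real (t - Suc u) - C)
        + D / 2 * (C + 1) - D / 2 * \<epsilon>"
      unfolding m by (simp add: algebra_simps add_divide_distrib diff_divide_distrib)
    moreover have "0 \<le> D / 2 * \<epsilon>" using D eps by simp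
    ultimately show ?thesis using 1 2 3 h by linarith
  qed
qed

section \<open>Localization on the best edge and deterministic estimates\<close>

text \<open>An excursion is replaced by greedy play on \<open>{l, l + 1}\<close> over the same
  times. It starts at a non-high site and so pays \<open>h\<close> at once, which exceeds the
  fluctuation terms of both walks, while \<open>gap\<close> compares the terms linear in the
  duration. The strict inequality on \<open>h\<close> contradicts optimality.\<close>

lemma localization:
  assumes opt: "optimal_walk b f n \<gamma>" and l: "l \<in> \<gamma> ` {0..n}"
    and R: "\<And>i. i \<le> n \<Longrightarrow> \<bar>\<gamma> i\<bar> \<le> R"
    and tri: "\<And>p. \<bar>p\<bar> \<le> R + 1 \<Longrightarrow>
        \<not> (c - h < \<bar>f (p - 1)\<bar> \<and> c - h < \<bar>f p\<bar> \<and> c - h < \<bar>f (p + 1)\<bar>)"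
    and S: "\<And>u v. 1 \<le> u \<Longrightarrow> u \<le> v \<Longrightarrow> v \<le> Suc n \<Longrightarrow>
        \<bar>\<Sum>i=u..<v. b (int i)\<bar> \<le> \<epsilon> * real (v - u) + C"
    and edges: "\<And>p. p \<in> \<gamma> ` {0..n} \<Longrightarrow> 2 \<le> \<bar>p - l\<bar> \<Longrightarrow> D \<le> disc p"
    and D: "0 \<le> D" "D \<le> 2 * c" and C: "0 \<le> C" and eps: "0 \<le> \<epsilon>" "\<epsilon> \<le> 1"
    and gap: "(1 + \<epsilon>) * disc l \<le> (1 - \<epsilon>) * D"
    and h: "D / 2 * (C + 1) + disc l / 2 * C < h" and lh: "disc l < h"
    and i: "hit_time \<gamma> l \<le> i" "i \<le> n"
  shows "\<gamma> i \<in> {l, l + 1}"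
proof (rule ccontr)
  assume bad: "\<gamma> i \<notin> {l, l + 1}"
  define E where "E = {l, l + 1}"
  have lazy: "\<bar>\<gamma> (Suc j) - \<gamma> j\<bar> \<le> 1" if "j < n" for j
    using opt that by (auto simp: optimal_walk_def lazy_walk_def)
  have hit: "\<gamma> (hit_time \<gamma> l) \<in> E"
    unfolding hit_time_def E_def by (rule LeastI_ex) (use l in auto)
  \<comment> \<open>\<open>s0\<close> is the last visit to the edge up to time \<open>i\<close>, and
    \<open>t\<close> the next one after \<open>i\<close>; \<open>t = Suc n\<close> encodes an
    excursion that does not return.\<close>
  define s0 where "s0 = (GREATEST j. j \<le> i \<and> \<gamma> j \<in> E)"
  have s0: "s0 \<le> i \<and> \<gamma> s0 \<in> E"
    unfolding s0_def by (rule GreatestI_nat[where b = i]) (use hit i in auto)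
  have s0max: "j \<le> s0" if "j \<le> i" "\<gamma> j \<in> E" for j
    unfolding s0_def by (rule Greatest_le_nat[where b = i]) (use that in auto)
  define t where "t = (LEAST j. i < j \<and> (j = Suc n \<or> \<gamma> j \<in> E))"
  have t: "i < t \<and> (t = Suc n \<or> \<gamma> t \<in> E)"
    unfolding t_def by (rule LeastI[where k = "Suc n"]) (use i in auto)
  have tmin: "t \<le> j" if "i < j" "j = Suc n \<or> \<gamma> j \<in> E" for j
    unfolding t_def by (rule Least_le) (use that in auto)
  have tn: "t \<le> Suc n" using tmin[of "Suc n"] i by auto
  define s where "s = Suc s0"
  have si: "1 \<le> s" "s \<le> i" using s0 bad by (auto simp: s_def E_def le_less Suc_le_eq)
  have st: "s < t" using si t by auto
  have out: "\<gamma> j \<notin> E" if "j \<in> {s..<t}" for j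
  proof (cases "j \<le> i")
    case True
    then show ?thesis using s0max[of j] that by (auto simp: s_def)
  next
    case False
    then show ?thesis using tmin[of j] that by auto
  qed
  define \<gamma>' where "\<gamma>' j = (if j \<in> {s..<t} then edge_opt b f l j else \<gamma> j)" for j
  \<comment> \<open>Both seams lie on the edge as well, so every step of the new walk from
    \<open>s0\<close> to \<open>t\<close> joins two points of \<open>E\<close> and is lazy.\<close>
  have inE: "\<gamma>' j \<in> E" if "j \<in> {s0..<t} \<or> j = t \<and> t \<le> n" for j
  proof (cases "j \<in> {s..<t}")
    case True
    then show ?thesis by (auto simp: \<gamma>'_def edge_opt_def E_def)
  next
    case False
    then have "j = s0 \<or> j = t \<and> t \<le> n" using that by (auto simp: s_def)
    then show ?thesis using False t s0 by (auto simp: \<gamma>'_def)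
  qed
  have "lazy_walk n \<gamma>'"
    unfolding lazy_walk_def
  proof (intro allI impI)
    fix j assume j: "j < n"
    show "\<bar>\<gamma>' (Suc j) - \<gamma>' j\<bar> \<le> 1"
    proof (cases "j \<in> {s0..<t}")
      case True
      then have "\<gamma>' j \<in> E" "\<gamma>' (Suc j) \<in> E" using j inE[of j] inE[of "Suc j"] by force+
      then show ?thesis by (auto simp: E_def)
    next
      case False
      then have "\<gamma>' j = \<gamma> j" "\<gamma>' (Suc j) = \<gamma> (Suc j)" by (auto simp: \<gamma>'_def s_def)
      then show ?thesis using lazy[OF j] by simp
    qed
  qed
  moreover have "\<gamma>' 0 = 0" using opt si by (auto simp: \<gamma>'_def optimal_walk_def)
  ultimately have "action b f n \<gamma> \<le> action b f n \<gamma>'"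
    using opt by (auto simp: optimal_walk_def)
  then have total: "(\<Sum>i=1..<Suc n. cost \<gamma> i) \<le> (\<Sum>i=1..<Suc n. cost \<gamma>' i)"
    by (simp only: sum_step_cost)
  have split: "(\<Sum>i=1..<Suc n. w i) = (\<Sum>i\<in>{1..<Suc n} - {s..<t}. w i) + (\<Sum>i=s..<t. w i)"
    for w :: "nat \<Rightarrow> real"
    using si tn by (intro sum.subset_diff) auto
  have "(\<Sum>i\<in>{1..<Suc n} - {s..<t}. cost \<gamma> i) = (\<Sum>i\<in>{1..<Suc n} - {s..<t}. cost \<gamma>' i)"
    by (rule sum.cong) (auto simp: \<gamma>'_def step_cost_def)
  with total have le: "(\<Sum>i=s..<t. cost \<gamma> i) \<le> (\<Sum>i=s..<t. cost \<gamma>' i)"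
    using split[of "cost \<gamma>"] split[of "cost \<gamma>'"] by linarith
  define S0 where "S0 = (\<Sum>i=s..<t. b (int i))"
  have S0: "\<bar>S0\<bar> \<le> \<epsilon> * real (t - s) + C" unfolding S0_def using S[of s t] si st tn by auto
  have "(\<Sum>i=s..<t. cost \<gamma>' i) = (\<Sum>i=s..<t. disc l / 2 + b (int i) * ((f l + f (l + 1)) / 2))"
    by (rule sum.cong[OF refl], rule edge_opt_cost) (simp add: \<gamma>'_def)
  also have "\<dots> = disc l / 2 * real (t - s) + S0 * ((f l + f (l + 1)) / 2)"
    by (simp only: sum.distrib S0_def sum_distrib_right) simp
  also have "\<dots> \<le> disc l / 2 * real (t - s) + \<bar>S0\<bar> * (disc l / 2)"
  proof -
    have "\<bar>S0 * (f l + f (l + 1))\<bar> \<le> \<bar>S0\<bar> * disc l"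
      using edge_sum_le_disc[of l] by (simp add: abs_mult mult_left_mono)
    then show ?thesis by simp
  qed
  also have "\<dots> \<le> disc l / 2 * real (t - s) + (\<epsilon> * real (t - s) + C) * (disc l / 2)"
    using S0 disc_nonneg[of l] by (intro add_left_mono mult_right_mono) auto
  finally have upper: "(\<Sum>i=s..<t. cost \<gamma>' i) \<le>
      (1 + \<epsilon>) * disc l / 2 * real (t - s) + disc l / 2 * C"
    by (simp add: algebra_simps add_divide_distrib)
  have sn: "s \<le> n" using st tn by simp
  have lR: "\<bar>l\<bar> \<le> R" using l R by auto
  \<comment> \<open>A discrepancy below \<open>h\<close> makes both endpoints high, so their outer
    neighbours \<open>l - 1\<close> and \<open>l + 2\<close> are not.\<close>
  have Gl: "c - h < \<bar>f l\<bar>" "c - h < \<bar>f (l + 1)\<bar>"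
    using lh f_bound[of l] f_bound[of "l + 1"] by (auto simp: discrepancy_def)
  have "\<gamma> s = l - 1 \<or> \<gamma> s = l + 2"
    using lazy[of s0] s0 out[of s] st sn by (auto simp: s_def E_def)
  moreover have "\<bar>l\<bar> \<le> R + 1" "\<bar>l + 1\<bar> \<le> R + 1" using lR by auto
  ultimately have "\<bar>f (\<gamma> s)\<bar> \<le> c - h"
    using tri[of l] tri[of "l + 1"] Gl by (auto simp: algebra_simps)
  then have first: "h \<le> cost \<gamma> s" using cost_ge_gap[of \<gamma> s] by linarith
  have rest: "D / 2 * ((1 - \<epsilon>) * real (t - Suc s) - C) \<le> (\<Sum>i=Suc s..<t. cost \<gamma> i)"
  proof (rule walk_cost_ge[where R = R and h = h])
    fix p assume "p \<in> \<gamma> ` {Suc s..<t}" "p + 1 \<in> \<gamma> ` {Suc s..<t}"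
    then obtain j k where jk: "j \<in> {Suc s..<t}" "k \<in> {Suc s..<t}" "p = \<gamma> j" "p + 1 = \<gamma> k" by auto
    \<comment> \<open>This rules out the edge at \<open>l\<close> and the two edges sharing a site
      with it, about which no gap in discrepancy is assumed.\<close>
    have "p \<notin> E" "p + 1 \<notin> E" using jk out[of j] out[of k] by auto
    then have "2 \<le> \<bar>p - l\<bar>" by (auto simp: E_def)
    moreover have "p \<in> \<gamma> ` {0..n}" using jk tn by auto
    ultimately show "D \<le> disc p" using edges by blast
  next
    show "D / 2 * (C + 1) \<le> h" using h disc_nonneg[of l] C by (smt (verit) divide_nonneg_nonneg mult_nonneg_nonneg)
  qed (use st tn si D C eps R S lazy tri in auto)
  have "(\<Sum>i=s..<t. cost \<gamma> i) = cost \<gamma> s + (\<Sum>i=Suc s..<t. cost \<gamma> i)"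
    using st by (rule sum.atLeast_Suc_lessThan)
  moreover have m: "real (t - s) = real (t - Suc s) + 1" using st by simp
  have "(1 + \<epsilon>) * disc l / 2 * real (t - s) \<le> (1 - \<epsilon>) * D / 2 * real (t - s)"
    using gap by (intro mult_right_mono) auto
  moreover have "(1 - \<epsilon>) * D / 2 * real (t - s) =
       D / 2 * ((1 - \<epsilon>) * real (t - Suc s) - C) + D / 2 * (C + 1) - D / 2 * \<epsilon>"
    unfolding m by (simp add: algebra_simps add_divide_distrib diff_divide_distrib)
  moreover have "0 \<le> D / 2 * \<epsilon>" using D eps by simp
  ultimately show False using le upper first rest h by linarith
qed

text \<open>Here \<open>\<delta>\<close> is the scale of small discrepancies and \<open>A\<close>
  the constant in the upper bound for the cost. The threshold \<open>8 * A\<close> is forced by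
  comparing the lower bound \<open>D * \<delta> * n / 8\<close> with
  \<open>A * \<delta> * n\<close>.\<close>

lemma optimal_walk_estimates:
  fixes \<gamma> :: "nat \<Rightarrow> int" and A K1 \<delta> :: real and R :: nat
  defines "A \<equiv> 2 * c + K1"
  assumes opt: "optimal_walk b f n \<gamma>" and l: "l \<in> \<gamma> ` {0..n}"
    and lmin: "\<And>x. x \<in> \<gamma> ` {0..n} \<Longrightarrow> disc l \<le> disc x"
    and n: "0 < n" and \<delta>: "0 < \<delta>" and K1: "0 \<le> K1"
    and x0: "x0 \<le> n" "real x0 \<le> \<delta> * real n" "disc (int x0) \<le> K1 * \<delta>"
    and right: "real R / 2 \<le> real (card {x\<in>{1..int R}. \<bar>f x\<bar> \<le> \<theta>})"
    and left: "real R / 2 \<le> real (card {x\<in>{- int R..-1}. \<bar>f x\<bar> \<le> \<theta>})"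
    and th: "\<theta> \<le> c" and R: "A * (\<delta> * real n) < (c - \<theta>) * (real R / 2)"
    and tri: "\<And>p. \<bar>p\<bar> \<le> int R + 1 \<Longrightarrow>
        \<not> (c - h < \<bar>f (p - 1)\<bar> \<and> c - h < \<bar>f p\<bar> \<and> c - h < \<bar>f (p + 1)\<bar>)"
    and S: "\<And>u v. 1 \<le> u \<Longrightarrow> u \<le> v \<Longrightarrow> v \<le> Suc n \<Longrightarrow>
        \<bar>\<Sum>i=u..<v. b (int i)\<bar> \<le> \<epsilon> * real (v - u) + C"
    and eps: "0 \<le> \<epsilon>" "\<epsilon> \<le> 1/2" and C: "0 \<le> C" "C \<le> real n / 4"
    and low: "\<And>x. \<bar>x\<bar> \<le> int R \<Longrightarrow> k3 * \<delta> \<le> disc x" and k3: "0 \<le> k3"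
    and far: "\<And>x. real_of_int \<bar>x\<bar> \<le> k4 * (\<delta> * real n) \<Longrightarrow> 8 * A * \<delta> < disc x"
    and gap: "\<And>x y. \<bar>x\<bar> \<le> int R \<Longrightarrow> \<bar>y\<bar> \<le> int R \<Longrightarrow> 2 \<le> \<bar>x - y\<bar> \<Longrightarrow> disc y \<le> 8 * A * \<delta>
        \<Longrightarrow> \<eta> * \<delta> < \<bar>disc y - disc x\<bar>"
    and eta: "0 < \<eta>" "16 * A * \<epsilon> \<le> (1 - \<epsilon>) * \<eta>"
    and h: "(8 * A + 1 + \<eta>) * \<delta> * (C + 1) < h"
    and small: "(8 * A + 1 + \<eta>) * \<delta> \<le> 2 * c"
  shows "\<forall>i. hit_time \<gamma> l \<le> i \<and> i \<le> n \<longrightarrow> \<gamma> i \<in> {l, l + 1}"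
    and "k4 * (\<delta> * real n) < real_of_int \<bar>l\<bar>" and "\<bar>l\<bar> \<le> int R"
    and "k3 * \<delta> \<le> disc l" and "disc l \<le> 8 * A * \<delta>"
    and "k3 / 8 * (\<delta> * real n) \<le> c * real n + action b f n \<gamma>"
    and "c * real n + action b f n \<gamma> \<le> A * (\<delta> * real n)"
proof -
  define T where "T = (\<Sum>i=1..<Suc n. cost \<gamma> i)"
  have T: "T = c * real n + action b f n \<gamma>" unfolding T_def by (rule sum_step_cost)
  have A: "0 < A" using K1 c_pos by (simp add: A_def)
  have lazy: "lazy_walk n \<gamma>" "\<gamma> 0 = 0" using opt by (auto simp: optimal_walk_def)
  have "T \<le> 2 * c * real x0 + disc (int x0) * real n"
    unfolding T_def by (rule optimal_cost_le[OF opt x0(1)])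
  also have "\<dots> \<le> 2 * c * (\<delta> * real n) + K1 * \<delta> * real n"
    using x0 c_pos by (intro add_mono mult_left_mono mult_right_mono) auto
  also have "\<dots> = A * (\<delta> * real n)" by (simp add: A_def algebra_simps)
  finally have T_le: "T \<le> A * (\<delta> * real n)" .
  then show "c * real n + action b f n \<gamma> \<le> A * (\<delta> * real n)" using T by simp
  have range: "\<bar>\<gamma> i\<bar> \<le> int R" if "i \<le> n" for i
  proof (rule ccontr)
    assume "\<not> \<bar>\<gamma> i\<bar> \<le> int R"
    then have "(c - \<theta>) * (real R / 2) \<le> T"
      unfolding T_def using range_cost_ge[OF lazy that _ right left th] by auto
    then show False using T_le R by linarith
  qed
  show lR: "\<bar>l\<bar> \<le> int R" using l range by auto
  show "k3 * \<delta> \<le> disc l" using low[OF lR] .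
  \<comment> \<open>The divisor 8 combines half a discrepancy per step with at least
    \<open>n / 4\<close> effective steps. The cap on \<open>D\<close> keeps the cut condition within
    the hypothesis on \<open>h\<close>.\<close>
  have bound: "D * \<delta> * real n / 8 \<le> T"
    if D: "0 \<le> D" "D \<le> 8 * A + 1" and edges: "\<And>p. p \<in> \<gamma> ` {0..n} \<Longrightarrow> D * \<delta> \<le> disc p" for D
  proof -
    have D\<delta>: "0 \<le> D * \<delta>" "D * \<delta> \<le> (8 * A + 1 + \<eta>) * \<delta>"
      using D eta \<delta> by (auto intro!: mult_right_mono)
    have "D * \<delta> / 2 * ((1 - \<epsilon>) * real (Suc n - 1) - C) \<le> T"
      unfolding T_def
    proof (rule walk_cost_ge[where R = "int R" and h = h])
      have "D * \<delta> / 2 * (C + 1) \<le> (8 * A + 1 + \<eta>) * \<delta> * (C + 1)"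
        using D\<delta> C by (intro mult_right_mono) auto
      then show "D * \<delta> / 2 * (C + 1) \<le> h" using h by simp
      show "D * \<delta> \<le> 2 * c" using D\<delta> small by simp
      show "\<bar>\<gamma> (Suc i) - \<gamma> i\<bar> \<le> 1" if "Suc i < Suc n" for i
        using lazy that by (auto simp: lazy_walk_def)
      show "D * \<delta> \<le> disc p" if "p \<in> \<gamma> ` {1..<Suc n}" for p
        using that by (intro edges) auto
    qed (use range S tri D\<delta> C eps in auto)
    moreover have "real n / 4 \<le> (1 - \<epsilon>) * real n - C"
    proof -
      have "\<epsilon> * real n \<le> 1/2 * real n" using eps by (intro mult_right_mono) auto
      then show ?thesis using C by (simp add: algebra_simps)
    qed
    then have "D * \<delta> / 2 * (real n / 4) \<le> D * \<delta> / 2 * ((1 - \<epsilon>) * real n - C)"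
      using D\<delta> by (intro mult_left_mono) auto
    ultimately show ?thesis by simp
  qed
  show "k3 / 8 * (\<delta> * real n) \<le> c * real n + action b f n \<gamma>"
  proof (cases "k3 \<le> 8 * A + 1")
    case True
    have "k3 * \<delta> \<le> disc p" if "p \<in> \<gamma> ` {0..n}" for p
      using that range by (intro low) auto
    then have "k3 * \<delta> * real n / 8 \<le> T" using True k3 by (intro bound) auto
    then show ?thesis using T by simp
  next
    \<comment> \<open>Impossible: already the capped value \<open>8 * A + 1\<close> contradicts the
      upper bound on the cost.\<close>
    case False
    have "(8 * A + 1) * \<delta> \<le> disc p" if "p \<in> \<gamma> ` {0..n}" for p
    proof -
      have "(8 * A + 1) * \<delta> \<le> k3 * \<delta>" using False \<delta> by (intro mult_right_mono) auto
      also have "\<dots> \<le> disc p" using that range by (intro low) auto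
      finally show ?thesis .
    qed
    then have "(8 * A + 1) * \<delta> * real n / 8 \<le> T" using A by (intro bound) auto
    moreover have "0 < \<delta> * real n" using \<delta> n by simp
    ultimately show ?thesis using T_le by (simp add: algebra_simps)
  qed
  show dl: "disc l \<le> 8 * A * \<delta>"
  proof (rule ccontr)
    assume *: "\<not> disc l \<le> 8 * A * \<delta>"
    \<comment> \<open>Truncation makes \<open>bound\<close> applicable while keeping
      \<open>D\<close> above \<open>8 * A\<close>.\<close>
    define D where "D = min (8 * A + 1) (disc l / \<delta>)"
    have "8 * A < disc l / \<delta>" using * \<delta> by (simp add: field_simps)
    then have D: "8 * A < D" "D \<le> 8 * A + 1" "D * \<delta> \<le> disc l"
      using \<delta> by (auto simp: D_def min_def field_simps)
    have "D * \<delta> * real n / 8 \<le> T"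
      using D A lmin by (intro bound) (auto intro: order_trans)
    moreover have "8 * A * (\<delta> * real n) < D * (\<delta> * real n)"
      using D \<delta> n by (intro mult_strict_right_mono) auto
    ultimately show False using T_le by (simp add: algebra_simps)
  qed
  show "k4 * (\<delta> * real n) < real_of_int \<bar>l\<bar>"
    using far[of l] dl by force
  show "\<forall>i. hit_time \<gamma> l \<le> i \<and> i \<le> n \<longrightarrow> \<gamma> i \<in> {l, l + 1}"
  proof (intro allI impI)
    fix i assume i: "hit_time \<gamma> l \<le> i \<and> i \<le> n"
    have D: "disc l + \<eta> * \<delta> \<le> (8 * A + 1 + \<eta>) * \<delta>"
      using dl \<delta> by (simp add: algebra_simps)
    \<comment> \<open>Minimality of \<open>l\<close> fixes the sign inside the absolute value of
      \<open>gap\<close>.\<close>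
    have "disc l + \<eta> * \<delta> \<le> disc p" if "p \<in> \<gamma> ` {0..n}" "2 \<le> \<bar>p - l\<bar>" for p
      using gap[of p l] that range lR dl lmin[of p] by (force simp: abs_if split: if_splits)
    moreover have "(1 + \<epsilon>) * disc l \<le> (1 - \<epsilon>) * (disc l + \<eta> * \<delta>)"
    proof -
      have "2 * \<epsilon> * disc l \<le> 2 * \<epsilon> * (8 * A * \<delta>)" using dl eps by (intro mult_left_mono) auto
      also have "\<dots> = 16 * A * \<epsilon> * \<delta>" by simp
      also have "\<dots> \<le> (1 - \<epsilon>) * \<eta> * \<delta>" using eta \<delta> by (intro mult_right_mono) auto
      finally show ?thesis by (simp add: algebra_simps)
    qed
    moreover have "(disc l + \<eta> * \<delta>) / 2 * (C + 1) + disc l / 2 * C < h"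
    proof -
      have "0 \<le> \<eta> * \<delta>" using eta \<delta> by simp
      then have "disc l / 2 * C \<le> (disc l + \<eta> * \<delta>) / 2 * (C + 1)"
        using C disc_nonneg[of l] by (intro mult_mono) auto
      then have "(disc l + \<eta> * \<delta>) / 2 * (C + 1) + disc l / 2 * C \<le> (disc l + \<eta> * \<delta>) * (C + 1)"
        by simp
      also have "\<dots> \<le> (8 * A + 1 + \<eta>) * \<delta> * (C + 1)"
        using D C by (intro mult_right_mono) auto
      finally show ?thesis using h by simp
    qed
    moreover have "disc l < h"
    proof -
      have "disc l \<le> (8 * A + 1 + \<eta>) * \<delta> * 1" using D eta \<delta> by (smt (verit) mult_pos_pos)
      also have "\<dots> \<le> (8 * A + 1 + \<eta>) * \<delta> * (C + 1)"
        using A eta \<delta> C by (intro mult_left_mono) auto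
      finally show ?thesis using h by simp
    qed
    ultimately show "\<gamma> i \<in> {l, l + 1}"
      using i D small C eps eta \<delta> disc_nonneg[of l]
      by (intro localization[OF opt l range tri S, where D = "disc l + \<eta> * \<delta>"]) auto
  qed
qed

end

section \<open>Conditioning on one of two independent variables, and a power integral\<close>

lemma (in prob_space) indep_vars_pair:
  assumes ind: "indep_vars (\<lambda>_. N) X I" and xy: "x \<in> I" "y \<in> I" "x \<noteq> y"
  shows "indep_var N (X x) N (X y)"
proof -
  have "indep_var (PiM {x} (\<lambda>_. N)) (\<lambda>\<omega>. restrict (\<lambda>i. X i \<omega>) {x})
     (PiM {y} (\<lambda>_. N)) (\<lambda>\<omega>. restrict (\<lambda>i. X i \<omega>) {y})"
    by (rule indep_var_restrict[OF ind]) (use xy in auto)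
  then have "indep_var N ((\<lambda>g. g x) \<circ> (\<lambda>\<omega>. restrict (\<lambda>i. X i \<omega>) {x}))
     N ((\<lambda>g. g y) \<circ> (\<lambda>\<omega>. restrict (\<lambda>i. X i \<omega>) {y}))"
    by (rule indep_var_compose) (auto intro!: measurable_component_singleton)
  then show ?thesis by (simp add: comp_def)
qed

text \<open>Fubini for the product law: given \<open>X = x\<close>, the probability is that of a
  section in \<open>Y\<close>, which \<open>S\<close> bounds uniformly. The probability of
  \<open>X\<close> lying in \<open>A\<close> survives as a factor.\<close>

lemma (in prob_space) prob_indep_section_le:
  assumes ind: "indep_var borel X borel Y" and A[measurable]: "A \<in> sets borel"
    and Q[measurable]: "Measurable.pred (borel \<Otimes>\<^sub>M borel) (\<lambda>(x, y). Q x y)"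
    and S: "\<And>x. x \<in> A \<Longrightarrow> prob {\<omega>\<in>space M. Q x (Y \<omega>)} \<le> S" and S0: "0 \<le> S"
  shows "prob {\<omega>\<in>space M. X \<omega> \<in> A \<and> Q (X \<omega>) (Y \<omega>)} \<le> prob {\<omega>\<in>space M. X \<omega> \<in> A} * S"
proof -
  note rv[measurable] = indep_var_rv1[OF ind] indep_var_rv2[OF ind]
  interpret DY: prob_space "distr M borel Y" by (rule prob_space_distr) simp
  define W where "W = {p \<in> space (borel \<Otimes>\<^sub>M borel). fst p \<in> A \<and> (\<lambda>(x, y). Q x y) p}"
  have W[measurable]: "W \<in> sets (borel \<Otimes>\<^sub>M borel)" unfolding W_def by measurable
  have sec: "emeasure (distr M borel Y) (Pair x -` W) \<le> ennreal S * indicator A x" for x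
  proof (cases "x \<in> A")
    case True
    have "Pair x -` W \<in> sets borel" using W by (rule sets_Pair1)
    then have "emeasure (distr M borel Y) (Pair x -` W) = emeasure M (Y -` (Pair x -` W) \<inter> space M)"
      by (simp add: emeasure_distr)
    also have "Y -` (Pair x -` W) \<inter> space M = {\<omega>\<in>space M. Q x (Y \<omega>)}"
      using True by (auto simp: W_def space_pair_measure)
    finally show ?thesis using S[OF True] True by (simp add: emeasure_eq_measure ennreal_leI)
  next
    case False
    then have "Pair x -` W = {}" by (auto simp: W_def)
    then show ?thesis by simp
  qed
  have "{\<omega>\<in>space M. X \<omega> \<in> A \<and> Q (X \<omega>) (Y \<omega>)} = (\<lambda>\<omega>. (X \<omega>, Y \<omega>)) -` W \<inter> space M"
    by (auto simp: W_def space_pair_measure)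
  then have "ennreal (prob {\<omega>\<in>space M. X \<omega> \<in> A \<and> Q (X \<omega>) (Y \<omega>)}) =
      emeasure (distr M (borel \<Otimes>\<^sub>M borel) (\<lambda>\<omega>. (X \<omega>, Y \<omega>))) W"
    by (simp add: emeasure_distr emeasure_eq_measure)
  also have "\<dots> = emeasure (distr M borel X \<Otimes>\<^sub>M distr M borel Y) W"
    using ind by (simp add: indep_var_distribution_eq)
  also have "\<dots> = (\<integral>\<^sup>+x. emeasure (distr M borel Y) (Pair x -` W) \<partial>distr M borel X)"
    by (rule DY.emeasure_pair_measure_alt) simp
  also have "\<dots> \<le> (\<integral>\<^sup>+x. ennreal S * indicator A x \<partial>distr M borel X)"
    by (intro nn_integral_mono sec)
  also have "\<dots> = ennreal S * emeasure (distr M borel X) A"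
    by (subst nn_integral_cmult_indicator) auto
  also have "emeasure (distr M borel X) A = ennreal (prob {\<omega>\<in>space M. X \<omega> \<in> A})"
    by (simp add: emeasure_distr emeasure_eq_measure vimage_def Int_def conj_commute)
  also have "ennreal S * \<dots> = ennreal (prob {\<omega>\<in>space M. X \<omega> \<in> A} * S)"
    using S0 by (simp add: ennreal_mult' mult.commute)
  finally show ?thesis using S0 by (subst (asm) ennreal_le_iff) auto
qed

text \<open>For \<open>a < 1\<close> the integrand is unbounded near 0, so the antiderivative is
  only required to be continuous up to the endpoints and differentiable inside.\<close>

lemma has_integral_powr_interval:
  fixes a v w :: real
  assumes "0 < a" "0 \<le> v" "v \<le> w"
  shows "((\<lambda>s. s powr (a - 1)) has_integral ((w powr a - v powr a) / a)) {v..w}"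
proof -
  have "continuous_on {v..w} (\<lambda>s. s powr a / a)"
    using assms by (intro continuous_on_divide continuous_on_powr' continuous_intros) auto
  then have "((\<lambda>s. s powr (a - 1)) has_integral (w powr a / a - v powr a / a)) {v..w}"
    using assms
    by (intro fundamental_theorem_of_calculus_interior)
       (auto intro!: derivative_eq_intros
         simp: has_real_derivative_iff_has_vector_derivative[symmetric])
  then show ?thesis by (simp add: diff_divide_distrib)
qed

section \<open>The law of the random field near the edge of its support\<close>

locale sign_field = prob_space M for M :: "'a measure" +
  fixes F B :: "int \<Rightarrow> 'a \<Rightarrow> real" and \<rho> :: "real \<Rightarrow> real" and c q \<kappa> :: real
  assumes c_pos: "c > 0" and q_pos: "q > 0" and kappa: "\<kappa> > -1"
    and indep: "indep_vars (\<lambda>_. borel) (\<lambda>k. case k of Inl x \<Rightarrow> F x | Inr i \<Rightarrow> B i) UNIV"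
    and F_dist: "\<And>x. distributed M lborel (F x) (\<lambda>t. ennreal (\<rho> t))"
    and B_rv[measurable]: "\<And>i. B i \<in> borel_measurable M"
    and B_plus: "\<And>i. prob {\<omega> \<in> space M. B i \<omega> = 1} = 1/2"
    and B_minus: "\<And>i. prob {\<omega> \<in> space M. B i \<omega> = -1} = 1/2"
    and \<rho>_even: "\<And>t. \<rho> (-t) = \<rho> t"
    and \<rho>_zero: "\<And>t. t \<notin> {-c<..<c} \<Longrightarrow> \<rho> t = 0"
    and \<rho>_edge: "((\<lambda>t. \<rho> t / \<bar>c - t\<bar> powr \<kappa>) \<longlongrightarrow> q) (at_left c)"
begin

text \<open>The exponent of the distribution function at the edge: the mass within distance
  \<open>w\<close> of \<open>c\<close> is of order \<open>w powr a\<close>.\<close>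

definition a :: real where "a = \<kappa> + 1"

abbreviation disc :: "int \<Rightarrow> 'a \<Rightarrow> real" where
  "disc x \<omega> \<equiv> discrepancy c (\<lambda>y. F y \<omega>) x"

lemma a_pos: "0 < a" using kappa by (simp add: a_def)

lemma F_rv[measurable]: "F x \<in> borel_measurable M"
  using distributed_measurable[OF F_dist[of x]] by simp

lemma disc_rv[measurable]: "disc x \<in> borel_measurable M"
  unfolding discrepancy_def by measurable

lemma indep_F: "indep_vars (\<lambda>_. borel) F UNIV"
proof -
  have "indep_vars (\<lambda>_. borel) (\<lambda>x \<omega>. (\<lambda>g. g (Inl x)) (restrict (\<lambda>k. (case k of Inl x \<Rightarrow> F x | Inr i \<Rightarrow> B i) \<omega>) {Inl x})) UNIV"
    by (rule indep_vars_compose2[OF indep_vars_restrict[OF indep]])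
       (auto simp: disjoint_family_on_def intro!: measurable_component_singleton)
  then show ?thesis by simp
qed

lemma indep_B: "indep_vars (\<lambda>_. borel) B UNIV"
proof -
  have "indep_vars (\<lambda>_. borel) (\<lambda>x \<omega>. (\<lambda>g. g (Inr x)) (restrict (\<lambda>k. (case k of Inl x \<Rightarrow> F x | Inr i \<Rightarrow> B i) \<omega>) {Inr x})) UNIV"
    by (rule indep_vars_compose2[OF indep_vars_restrict[OF indep]])
       (auto simp: disjoint_family_on_def intro!: measurable_component_singleton)
  then show ?thesis by simp
qed

text \<open>Edges whose left endpoints are at least 2 apart share no site, so their discrepancies
  are functions of disjoint blocks of the field.\<close>

lemma indep_disc:
  assumes I: "\<And>x y. x \<in> I \<Longrightarrow> y \<in> I \<Longrightarrow> x \<noteq> y \<Longrightarrow> 2 \<le> \<bar>x - y\<bar>"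
  shows "indep_vars (\<lambda>_. borel) disc I"
proof -
  have "indep_vars (\<lambda>_. borel) (\<lambda>x \<omega>. (\<lambda>g. 2 * c - \<bar>g (x + 1) - g x\<bar>) (restrict (\<lambda>y. F y \<omega>) {x, x + 1})) I"
  proof (rule indep_vars_compose2[OF indep_vars_restrict[OF indep_F]])
    show "disjoint_family_on (\<lambda>x. {x, x + 1}) I"
      unfolding disjoint_family_on_def
    proof (intro ballI impI)
      fix x y assume "x \<in> I" "y \<in> I" "x \<noteq> y"
      then have "2 \<le> \<bar>x - y\<bar>" by (rule I)
      then show "{x, x + 1} \<inter> {y, y + 1} = {}" by auto
    qed
  qed (auto intro!: measurable_component_singleton borel_measurable_diff borel_measurable_abs)
  then show ?thesis by (simp add: discrepancy_def)
qed

lemma prob_indep_F2: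
  assumes "x \<noteq> y" "S \<in> sets borel" "T \<in> sets borel"
  shows "prob {\<omega>\<in>space M. F x \<omega> \<in> S \<and> F y \<omega> \<in> T} =
     prob {\<omega>\<in>space M. F x \<omega> \<in> S} * prob {\<omega>\<in>space M. F y \<omega> \<in> T}"
  using prob_indep_random_variable[OF indep_vars_pair[OF indep_F] assms(2,3), of x y] assms(1) by simp

text \<open>The sign \<open>\<sigma>\<close> selects an end of the support. Substituting the
  distance to that end and using evenness of \<open>\<rho>\<close> gives one formula for
  both.\<close>

lemma emeasure_edge_distance:
  assumes "\<sigma> = 1 \<or> \<sigma> = -1"
  shows "emeasure M {\<omega>\<in>space M. c - \<sigma> * F x \<omega> \<in> {v..w}} = (\<integral>\<^sup>+s. ennreal (\<rho> (c - s)) * indicator {v..w} s \<partial>lborel)"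
proof -
  have \<rho>[measurable]: "(\<lambda>t. ennreal (\<rho> t)) \<in> borel_measurable borel"
    using distributed_borel_measurable[OF F_dist[of 0]] by simp
  define T where "T = {t. c - \<sigma> * t \<in> {v..w}}"
  have T[measurable]: "T \<in> sets borel" unfolding T_def by measurable
  have "{\<omega>\<in>space M. c - \<sigma> * F x \<omega> \<in> {v..w}} = F x -` T \<inter> space M" by (auto simp: T_def)
  then have "emeasure M {\<omega>\<in>space M. c - \<sigma> * F x \<omega> \<in> {v..w}} = (\<integral>\<^sup>+t. ennreal (\<rho> t) * indicator T t \<partial>lborel)"
    using distributed_emeasure[OF F_dist[of x], of T] by simp
  also have "\<dots> = (\<integral>\<^sup>+s. ennreal (\<rho> (\<sigma> * c + (- \<sigma>) * s)) * indicator T (\<sigma> * c + (- \<sigma>) * s) \<partial>lborel)"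
    using assms by (subst nn_integral_real_affine[where c = "- \<sigma>" and t = "\<sigma> * c"]) auto
  also have "\<dots> = (\<integral>\<^sup>+s. ennreal (\<rho> (c - s)) * indicator {v..w} s \<partial>lborel)"
  proof (rule nn_integral_cong)
    fix s
    have "\<rho> (\<sigma> * c + (- \<sigma>) * s) = \<rho> (c - s)"
      using assms \<rho>_even[of "c - s"] by auto
    moreover have "\<sigma> * c + (- \<sigma>) * s \<in> T \<longleftrightarrow> s \<in> {v..w}"
      using assms by (auto simp: T_def)
    ultimately show "ennreal (\<rho> (\<sigma> * c + (- \<sigma>) * s)) * indicator T (\<sigma> * c + (- \<sigma>) * s) = ennreal (\<rho> (c - s)) * indicator {v..w} s"
      by (auto simp: indicator_def)
  qed
  finally show ?thesis .
qed

text \<open>Near \<open>c\<close> the density lies between \<open>q / 2\<close> and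
  \<open>2 * q\<close> times the distance to the power \<open>\<kappa>\<close>, and integration
  gives the bounds. The upper one is kept for arbitrary intervals because near ties are estimated
  with windows away from 0.\<close>

lemma edge_law:
  obtains u where "0 < u"
    "\<And>x \<sigma> v w. \<sigma> = 1 \<or> \<sigma> = -1 \<Longrightarrow> 0 \<le> v \<Longrightarrow> v \<le> w \<Longrightarrow> w \<le> u \<Longrightarrow>
      prob {\<omega>\<in>space M. c - \<sigma> * F x \<omega> \<in> {v..w}} \<le> 2 * q / a * (w powr a - v powr a)"
    "\<And>x \<sigma> w. \<sigma> = 1 \<or> \<sigma> = -1 \<Longrightarrow> 0 \<le> w \<Longrightarrow> w \<le> u \<Longrightarrow>
      q / (2 * a) * w powr a \<le> prob {\<omega>\<in>space M. c - \<sigma> * F x \<omega> \<in> {0..w}}"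
proof -
  have "eventually (\<lambda>t. q / 2 < \<rho> t / \<bar>c - t\<bar> powr \<kappa> \<and> \<rho> t / \<bar>c - t\<bar> powr \<kappa> < 2 * q) (at_left c)"
    using \<rho>_edge q_pos by (intro eventually_conj order_tendstoD) auto
  then obtain t0 where t0: "t0 < c" "\<And>t. t0 < t \<Longrightarrow> t < c \<Longrightarrow>
      q / 2 < \<rho> t / \<bar>c - t\<bar> powr \<kappa> \<and> \<rho> t / \<bar>c - t\<bar> powr \<kappa> < 2 * q"
    using eventually_at_left[of "c - 1" c] by auto
  define u where "u = (c - t0) / 2"
  have u: "0 < u" "u < c - t0" using t0(1) by (auto simp: u_def)
  have dens: "q / 2 * s powr (a - 1) \<le> \<rho> (c - s) \<and> \<rho> (c - s) \<le> 2 * q * s powr (a - 1)"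
    if "s \<in> {0..u}" for s
  proof (cases "s = 0")
    \<comment> \<open>At distance 0 all three terms vanish, by \<open>\<rho>_zero\<close> and the
      convention \<open>0 powr x = 0\<close>.\<close>
    case True
    then show ?thesis using \<rho>_zero[of c] by simp
  next
    case False
    then have "0 < s powr \<kappa>" "s > 0" using that by auto
    then show ?thesis using t0(2)[of "c - s"] that u by (auto simp: field_simps a_def)
  qed
  have int: "(\<integral>\<^sup>+s. ennreal (k * s powr (a - 1)) * indicator {v..w} s \<partial>lborel) = ennreal (k * ((w powr a - v powr a) / a))"
    if "0 \<le> v" "v \<le> w" "0 \<le> k" for v w k :: real
    using has_integral_mult_right[OF has_integral_powr_interval[OF a_pos that(1,2)], of k] that
    by (intro nn_integral_has_integral_lebesgue') auto
  show thesis
  proof (rule that[OF u(1)])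
    fix x :: int and \<sigma> v w :: real
    assume h: "\<sigma> = 1 \<or> \<sigma> = -1" "0 \<le> v" "v \<le> w" "w \<le> u"
    have "ennreal (prob {\<omega>\<in>space M. c - \<sigma> * F x \<omega> \<in> {v..w}}) =
        (\<integral>\<^sup>+s. ennreal (\<rho> (c - s)) * indicator {v..w} s \<partial>lborel)"
      using emeasure_edge_distance[OF h(1)] by (simp add: emeasure_eq_measure)
    also have "\<dots> \<le> (\<integral>\<^sup>+s. ennreal (2 * q * s powr (a - 1)) * indicator {v..w} s \<partial>lborel)"
      using dens h by (intro nn_integral_mono) (auto simp: indicator_def intro!: ennreal_leI)
    also have "\<dots> = ennreal (2 * q * ((w powr a - v powr a) / a))"
      using h q_pos by (intro int) auto
    finally show "prob {\<omega>\<in>space M. c - \<sigma> * F x \<omega> \<in> {v..w}} \<le> 2 * q / a * (w powr a - v powr a)"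
      using h q_pos a_pos powr_mono2[of a v w] by (subst (asm) ennreal_le_iff) auto
  next
    fix x :: int and \<sigma> w :: real
    assume h: "\<sigma> = 1 \<or> \<sigma> = -1" "0 \<le> w" "w \<le> u"
    have "ennreal (q / 2 * ((w powr a - 0 powr a) / a)) = (\<integral>\<^sup>+s. ennreal (q / 2 * s powr (a - 1)) * indicator {0..w} s \<partial>lborel)"
      using h q_pos by (intro int[symmetric]) auto
    also have "\<dots> \<le> (\<integral>\<^sup>+s. ennreal (\<rho> (c - s)) * indicator {0..w} s \<partial>lborel)"
      using dens h by (intro nn_integral_mono) (auto simp: indicator_def intro!: ennreal_leI)
    also have "\<dots> = ennreal (prob {\<omega>\<in>space M. c - \<sigma> * F x \<omega> \<in> {0..w}})"
      using emeasure_edge_distance[OF h(1), of x 0 w] by (simp only: emeasure_eq_measure)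
    finally show "q / (2 * a) * w powr a \<le> prob {\<omega>\<in>space M. c - \<sigma> * F x \<omega> \<in> {0..w}}"
      by (subst (asm) ennreal_le_iff) auto
  qed
qed

lemma AE_F_bound: "AE \<omega> in M. \<bar>F x \<omega>\<bar> \<le> c"
proof -
  define T where "T = {t::real. \<not> \<bar>t\<bar> \<le> c}"
  have T: "T \<in> sets lborel" unfolding T_def by measurable
  have "emeasure M (F x -` T \<inter> space M) = (\<integral>\<^sup>+t. ennreal (\<rho> t) * indicator T t \<partial>lborel)"
    by (rule distributed_emeasure[OF F_dist T])
  also have "\<dots> = (\<integral>\<^sup>+(t::real). 0 \<partial>lborel)"
  proof (rule nn_integral_cong)
    fix t
    have "\<rho> t = 0" if "t \<in> T" by (rule \<rho>_zero) (use that in \<open>auto simp: T_def\<close>)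
    then show "ennreal (\<rho> t) * indicator T t = 0" by (auto simp: indicator_def)
  qed
  finally have "emeasure M (F x -` T \<inter> space M) = 0" by simp
  moreover have "{\<omega>\<in>space M. \<not> \<bar>F x \<omega>\<bar> \<le> c} = F x -` T \<inter> space M" by (auto simp: T_def)
  ultimately show ?thesis
    using T measurable_sets[OF F_rv[of x], of T] by (subst AE_iff_measurable[OF _ refl]) auto
qed

lemma AE_B_sign: "AE \<omega> in M. B i \<omega> = 1 \<or> B i \<omega> = -1"
proof -
  have "prob ({\<omega> \<in> space M. B i \<omega> = 1} \<union> {\<omega> \<in> space M. B i \<omega> = -1}) = 1/2 + 1/2"
    unfolding B_plus[of i, symmetric] by (subst finite_measure_Union) (auto simp: B_plus B_minus)
  then have "prob {\<omega> \<in> space M. B i \<omega> = 1 \<or> B i \<omega> = -1} = 1"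
    by (simp add: Collect_disj_eq[symmetric] conj_disj_distribL[symmetric])
  then show ?thesis by (subst (asm) prob_Collect_eq_1) auto
qed

lemma expectation_B: "expectation (B i) = 0"
proof -
  have "expectation (B i) = expectation (\<lambda>\<omega>. indicator {\<omega> \<in> space M. B i \<omega> = 1} \<omega> - indicator {\<omega> \<in> space M. B i \<omega> = -1} \<omega>)"
    by (rule integral_cong_AE) (use AE_B_sign[of i] in \<open>auto simp: indicator_def\<close>)
  also have "\<dots> = prob {\<omega> \<in> space M. B i \<omega> = 1} - prob {\<omega> \<in> space M. B i \<omega> = -1}"
    by (subst Bochner_Integration.integral_diff) (auto simp: less_top[symmetric] intro!: integrable_real_indicator)
  finally show ?thesis by (simp add: B_plus B_minus)
qed

text \<open>Hoeffding's inequality. Allowing \<open>\<epsilon>\<close> per summand makes the bound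
  depend on \<open>C\<close> alone, so a union bound over all time intervals costs only a polynomial
  factor.\<close>

lemma prob_sign_sum_ge:
  assumes "finite I" "I \<noteq> {}" and eps: "0 < \<epsilon>" and C: "0 \<le> C"
  shows "prob {\<omega>\<in>space M. \<epsilon> * real (card I) + C \<le> \<bar>\<Sum>i\<in>I. B i \<omega>\<bar>} \<le> 2 * exp (- 2 * \<epsilon> * C)"
proof -
  define m where "m = real (card I)"
  have m: "0 < m" using assms by (simp add: m_def card_gt_0_iff)
  interpret H: Hoeffding_ineq M I B "\<lambda>_. -1" "\<lambda>_. 1" "\<Sum>i\<in>I. expectation (B i)"
  proof unfold_locales
    show "indep_vars (\<lambda>_. borel) B I" by (rule indep_vars_subset[OF indep_B]) simp
    show "AE \<omega> in M. B i \<omega> \<in> {- 1..1}" for i using AE_B_sign[of i] by eventually_elim auto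
  qed (use assms in auto)
  have sq: "(\<Sum>i\<in>I. (1 - (- 1 :: real))\<^sup>2) = 4 * m" by (simp add: m_def)
  have "prob {\<omega>\<in>space M. \<epsilon> * m + C \<le> \<bar>(\<Sum>i\<in>I. B i \<omega>) - (\<Sum>i\<in>I. expectation (B i))\<bar>}
      \<le> 2 * exp (- 2 * (\<epsilon> * m + C)\<^sup>2 / (\<Sum>i\<in>I. (1 - (- 1))\<^sup>2))"
    using m eps C sq by (intro H.Hoeffding_ineq_abs_ge) auto
  also have "\<dots> \<le> 2 * exp (- 2 * \<epsilon> * C)"
  proof -
    \<comment> \<open>AM-GM makes the bound independent of the number of summands.\<close>
    have "4 * (\<epsilon> * m) * C \<le> (\<epsilon> * m + C)\<^sup>2"
      using sum_squares_bound[of "\<epsilon> * m" C] by (simp add: power2_sum mult.commute mult.left_commute)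
    then show ?thesis unfolding sq using m by (simp add: field_simps)
  qed
  finally show ?thesis by (simp add: expectation_B m_def)
qed

end

lemma (in prob_space) prob_Bex_le:
  assumes "finite I" and "\<And>x. x \<in> I \<Longrightarrow> {\<omega>\<in>space M. P x \<omega>} \<in> events"
    and "\<And>x. x \<in> I \<Longrightarrow> prob {\<omega>\<in>space M. P x \<omega>} \<le> p"
  shows "prob {\<omega>\<in>space M. \<exists>x\<in>I. P x \<omega>} \<le> real (card I) * p"
proof -
  have "{\<omega>\<in>space M. \<exists>x\<in>I. P x \<omega>} = (\<Union>x\<in>I. {\<omega>\<in>space M. P x \<omega>})" by auto
  then have "prob {\<omega>\<in>space M. \<exists>x\<in>I. P x \<omega>} \<le> (\<Sum>x\<in>I. prob {\<omega>\<in>space M. P x \<omega>})"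
    using measure_UNION_le[of I "\<lambda>x. {\<omega>\<in>space M. P x \<omega>}" M] assms by simp
  also have "\<dots> \<le> (\<Sum>x\<in>I. p)" by (rule sum_mono) (rule assms)
  finally show ?thesis by simp
qed

section \<open>Law of the discrepancy and near ties between two edges\<close>

text \<open>With the orientation \<open>\<sigma>\<close> of the larger value, the discrepancy is the
  sum of the distances of the two values to opposite ends of the support.\<close>

lemma disc_decomposition:
  assumes "\<bar>f x\<bar> \<le> c" "\<bar>f (x + 1)\<bar> \<le> c"
  shows "\<exists>\<sigma>\<in>{1, -1}. discrepancy c f x = (c - \<sigma> * f x) + (c - (- \<sigma>) * f (x + 1)) \<and>
     0 \<le> c - \<sigma> * f x \<and> 0 \<le> c - (- \<sigma>) * f (x + 1)"
  using assms by (auto simp: discrepancy_def abs_if split: if_splits)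

text \<open>Having the radius \<open>u\<close> as a parameter lets all later estimates share one
  range of validity for the edge law.\<close>

locale sign_field_edge = sign_field +
  fixes u :: real
  assumes u_pos: "0 < u"
    and law_upper: "\<And>x \<sigma> v w. \<sigma> = 1 \<or> \<sigma> = -1 \<Longrightarrow> 0 \<le> v \<Longrightarrow> v \<le> w \<Longrightarrow> w \<le> u \<Longrightarrow>
      prob {\<omega>\<in>space M. c - \<sigma> * F x \<omega> \<in> {v..w}} \<le> 2 * q / a * (w powr a - v powr a)"
    and law_lower: "\<And>x \<sigma> w. \<sigma> = 1 \<or> \<sigma> = -1 \<Longrightarrow> 0 \<le> w \<Longrightarrow> w \<le> u \<Longrightarrow>
      q / (2 * a) * w powr a \<le> prob {\<omega>\<in>space M. c - \<sigma> * F x \<omega> \<in> {0..w}}"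
begin

definition Q :: real where "Q = 2 * q / a"

lemma Q_pos: "0 < Q" using q_pos a_pos by (simp add: Q_def)

lemma law0_upper:
  assumes "\<sigma> = 1 \<or> \<sigma> = -1" "0 \<le> w" "w \<le> u"
  shows "prob {\<omega>\<in>space M. c - \<sigma> * F x \<omega> \<in> {0..w}} \<le> Q * w powr a"
  using law_upper[of \<sigma> 0 w x] assms by (simp add: Q_def)

lemma prob_tail_le:
  assumes "0 \<le> w" "w \<le> u"
  shows "prob {\<omega>\<in>space M. c - w \<le> \<bar>F x \<omega>\<bar>} \<le> 2 * Q * w powr a"
proof -
  have "prob {\<omega>\<in>space M. c - w \<le> \<bar>F x \<omega>\<bar>} \<le>
     prob ({\<omega>\<in>space M. c - 1 * F x \<omega> \<in> {0..w}} \<union> {\<omega>\<in>space M. c - (-1) * F x \<omega> \<in> {0..w}})"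
    by (rule finite_measure_mono_AE) (use AE_F_bound[of x] in \<open>auto simp: abs_if elim!: eventually_mono\<close>)
  also have "\<dots> \<le> prob {\<omega>\<in>space M. c - 1 * F x \<omega> \<in> {0..w}} + prob {\<omega>\<in>space M. c - (-1) * F x \<omega> \<in> {0..w}}"
    by (rule measure_Un_le) auto
  also have "\<dots> \<le> Q * w powr a + Q * w powr a"
    using assms by (intro add_mono law0_upper) auto
  finally show ?thesis by simp
qed

lemma prob_edge_pair:
  assumes "x \<noteq> y"
  shows "prob {\<omega>\<in>space M. c - \<sigma> * F x \<omega> \<in> {0..w} \<and> c - \<tau> * F y \<omega> \<in> {0..w}} =
    prob {\<omega>\<in>space M. c - \<sigma> * F x \<omega> \<in> {0..w}} * prob {\<omega>\<in>space M. c - \<tau> * F y \<omega> \<in> {0..w}}"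
proof -
  have "{t. c - \<sigma> * t \<in> {0..w}} \<in> sets borel" "{t. c - \<tau> * t \<in> {0..w}} \<in> sets borel"
    by measurable
  from prob_indep_F2[OF assms this] show ?thesis by (simp only: mem_Collect_eq)
qed

text \<open>Almost surely one of the two orientations applies, and each distance is at most their
  sum. The predicate \<open>P\<close> serves tail bounds as well as windows.\<close>

lemma prob_disc_le_cases:
  assumes 1: "\<And>\<sigma>. \<sigma> = 1 \<or> \<sigma> = -1 \<Longrightarrow>
     prob {\<omega>\<in>space M. c - \<sigma> * F x \<omega> \<in> {0..U} \<and> c - (- \<sigma>) * F (x + 1) \<omega> \<in> {0..U} \<and>
        P ((c - \<sigma> * F x \<omega>) + (c - (- \<sigma>) * F (x + 1) \<omega>))} \<le> p"
    and [measurable]: "Measurable.pred borel P"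
  shows "prob {\<omega>\<in>space M. disc x \<omega> \<le> U \<and> P (disc x \<omega>)} \<le> 2 * p"
proof -
  define E where "E \<sigma> = {\<omega>\<in>space M. c - \<sigma> * F x \<omega> \<in> {0..U} \<and> c - (- \<sigma>) * F (x + 1) \<omega> \<in> {0..U} \<and>
        P ((c - \<sigma> * F x \<omega>) + (c - (- \<sigma>) * F (x + 1) \<omega>))}" for \<sigma>
  have [measurable]: "E \<sigma> \<in> events" for \<sigma> unfolding E_def by measurable
  have "prob {\<omega>\<in>space M. disc x \<omega> \<le> U \<and> P (disc x \<omega>)} \<le> prob (E 1 \<union> E (-1))"
  proof (rule finite_measure_mono_AE)
    show "AE \<omega> in M. \<omega> \<in> {\<omega>\<in>space M. disc x \<omega> \<le> U \<and> P (disc x \<omega>)} \<longrightarrow> \<omega> \<in> E 1 \<union> E (-1)"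
      using AE_F_bound[of x] AE_F_bound[of "x + 1"]
    proof eventually_elim
      case (elim \<omega>)
      show ?case
        using disc_decomposition[of "\<lambda>y. F y \<omega>" x c] elim by (fastforce simp: E_def)
    qed
  qed simp
  also have "\<dots> \<le> prob (E 1) + prob (E (-1))" by (rule measure_Un_le) auto
  also have "\<dots> \<le> p + p" unfolding E_def by (intro add_mono 1) auto
  finally show ?thesis by simp
qed

text \<open>A small sum of distances needs both to be small; independence squares the single-site
  bound and the orientations contribute the factor 2.\<close>

lemma prob_disc_le:
  assumes "0 \<le> w" "w \<le> u"
  shows "prob {\<omega>\<in>space M. disc x \<omega> \<le> w} \<le> 2 * Q\<^sup>2 * w powr (2 * a)"
proof -
  have "prob {\<omega>\<in>space M. disc x \<omega> \<le> w \<and> True} \<le> 2 * (Q * w powr a * (Q * w powr a))"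
  proof (rule prob_disc_le_cases)
    fix \<sigma> :: real assume s: "\<sigma> = 1 \<or> \<sigma> = -1"
    have "prob {\<omega>\<in>space M. c - \<sigma> * F x \<omega> \<in> {0..w} \<and> c - (- \<sigma>) * F (x + 1) \<omega> \<in> {0..w}} \<le>
       Q * w powr a * (Q * w powr a)"
      by (subst prob_edge_pair, simp, intro mult_mono law0_upper) (use s assms Q_pos in auto)
    then show "prob {\<omega>\<in>space M. c - \<sigma> * F x \<omega> \<in> {0..w} \<and> c - (- \<sigma>) * F (x + 1) \<omega> \<in> {0..w} \<and> True} \<le>
       Q * w powr a * (Q * w powr a)" by simp
  qed simp
  also have "\<dots> = 2 * Q\<^sup>2 * (w powr a * w powr a)" by (simp add: power2_eq_square)
  also have "w powr a * w powr a = w powr (2 * a)" by (simp flip: powr_add)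
  finally show ?thesis by simp
qed

text \<open>Two distances of at most \<open>w / 2\<close> in one fixed orientation already
  suffice.\<close>

lemma prob_disc_ge:
  assumes "0 \<le> w" "w \<le> 2 * u"
  shows "(q / (2 * a))\<^sup>2 * (w / 2) powr (2 * a) \<le> prob {\<omega>\<in>space M. disc x \<omega> \<le> w}"
proof -
  have "(w / 2) powr (2 * a) = (w / 2) powr a * (w / 2) powr a" by (simp flip: powr_add)
  then have "(q / (2 * a))\<^sup>2 * (w / 2) powr (2 * a) = (q / (2 * a) * (w / 2) powr a) * (q / (2 * a) * (w / 2) powr a)"
    by (simp add: power2_eq_square)
  also have "\<dots> \<le> prob {\<omega>\<in>space M. c - 1 * F x \<omega> \<in> {0..w/2}} * prob {\<omega>\<in>space M. c - (-1) * F (x + 1) \<omega> \<in> {0..w/2}}"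
    using assms q_pos a_pos by (intro mult_mono law_lower) auto
  also have "\<dots> = prob {\<omega>\<in>space M. c - 1 * F x \<omega> \<in> {0..w/2} \<and> c - (-1) * F (x + 1) \<omega> \<in> {0..w/2}}"
    by (rule prob_edge_pair[symmetric]) simp
  also have "\<dots> \<le> prob {\<omega>\<in>space M. disc x \<omega> \<le> w}"
    by (rule finite_measure_mono) (auto simp: discrepancy_def)
  finally show ?thesis .
qed

text \<open>Given the first distance, the second must lie in an interval of length at most
  \<open>2 * w\<close> inside \<open>{0..U}\<close>. The number \<open>\<mu>\<close> stands for a
  modulus of continuity of the power function, as a Lipschitz bound may fail for
  \<open>a < 1\<close>.\<close>

lemma prob_disc_near:
  assumes v: "0 \<le> v" "v + w \<le> U" and w: "0 \<le> w" and U: "U \<le> u" and \<mu>0: "0 \<le> \<mu>"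
    and \<mu>: "\<And>l h. 0 \<le> l \<Longrightarrow> l \<le> h \<Longrightarrow> h \<le> U \<Longrightarrow> h - l \<le> 2 * w \<Longrightarrow> h powr a - l powr a \<le> \<mu>"
  shows "prob {\<omega>\<in>space M. \<bar>v - disc x \<omega>\<bar> \<le> w} \<le> 2 * Q\<^sup>2 * U powr a * \<mu>"
proof -
  have U0: "0 \<le> U" using v w by simp
  have "prob {\<omega>\<in>space M. disc x \<omega> \<le> U \<and> \<bar>v - disc x \<omega>\<bar> \<le> w} \<le> 2 * (Q * U powr a * (Q * \<mu>))"
  proof (rule prob_disc_le_cases)
    fix \<sigma> :: real assume s: "\<sigma> = 1 \<or> \<sigma> = -1"
    define X where "X \<omega> = c - \<sigma> * F x \<omega>" for \<omega>
    define Y where "Y \<omega> = c - (- \<sigma>) * F (x + 1) \<omega>" for \<omega>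
    have ind: "indep_var borel X borel Y"
    proof -
      have "indep_var borel ((\<lambda>t. c - \<sigma> * t) \<circ> F x) borel ((\<lambda>t. c - (- \<sigma>) * t) \<circ> F (x + 1))"
        by (rule indep_var_compose[OF indep_vars_pair[OF indep_F]]) auto
      then show ?thesis by (simp add: comp_def X_def[abs_def] Y_def[abs_def])
    qed
    have "prob {\<omega>\<in>space M. X \<omega> \<in> {0..U} \<and> (Y \<omega> \<in> {0..U} \<and> \<bar>v - (X \<omega> + Y \<omega>)\<bar> \<le> w)} \<le>
        prob {\<omega>\<in>space M. X \<omega> \<in> {0..U}} * (Q * \<mu>)"
    proof (rule prob_indep_section_le[OF ind])
      fix \<xi> assume \<xi>: "\<xi> \<in> {0..U}"
      define l where "l = max 0 (v - w - \<xi>)"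
      define h where "h = min U (v + w - \<xi>)"
      have eq: "{\<omega>\<in>space M. Y \<omega> \<in> {0..U} \<and> \<bar>v - (\<xi> + Y \<omega>)\<bar> \<le> w} = {\<omega>\<in>space M. Y \<omega> \<in> {l..h}}"
        by (auto simp: l_def h_def abs_le_iff)
      show "prob {\<omega>\<in>space M. Y \<omega> \<in> {0..U} \<and> \<bar>v - (\<xi> + Y \<omega>)\<bar> \<le> w} \<le> Q * \<mu>"
      proof (cases "l \<le> h")
        case True
        have "h powr a - l powr a \<le> \<mu>"
          by (rule \<mu>) (use True \<xi> in \<open>auto simp: l_def h_def\<close>)
        then have "Q * (h powr a - l powr a) \<le> Q * \<mu>" using Q_pos by (intro mult_left_mono) auto
        moreover have "prob {\<omega>\<in>space M. Y \<omega> \<in> {l..h}} \<le> Q * (h powr a - l powr a)"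
          unfolding Y_def Q_def by (rule law_upper) (use s True U in \<open>auto simp: l_def h_def\<close>)
        ultimately show ?thesis unfolding eq by linarith
      next
        case False
        then have empty: "{\<omega>\<in>space M. Y \<omega> \<in> {l..h}} = {}" by auto
        show ?thesis unfolding eq empty using Q_pos \<mu>0 by simp
      qed
    qed (use Q_pos \<mu>0 in auto)
    also have "\<dots> \<le> Q * U powr a * (Q * \<mu>)"
      using s U0 U Q_pos \<mu>0 law0_upper[of \<sigma> U x] by (intro mult_right_mono) (auto simp: X_def)
    finally show "prob {\<omega>\<in>space M. c - \<sigma> * F x \<omega> \<in> {0..U} \<and> c - (- \<sigma>) * F (x + 1) \<omega> \<in> {0..U} \<and>
        \<bar>v - ((c - \<sigma> * F x \<omega>) + (c - (- \<sigma>) * F (x + 1) \<omega>))\<bar> \<le> w} \<le> Q * U powr a * (Q * \<mu>)"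
      unfolding X_def Y_def .
  qed simp
  also have "{\<omega>\<in>space M. disc x \<omega> \<le> U \<and> \<bar>v - disc x \<omega>\<bar> \<le> w} = {\<omega>\<in>space M. \<bar>v - disc x \<omega>\<bar> \<le> w}"
    using v by auto
  finally show ?thesis by (simp add: power2_eq_square mult_ac)
qed

text \<open>The two edges share no site, so conditioning on \<open>disc y\<close> reduces a tie to a
  window of half-width \<open>w\<close> around a fixed value.\<close>

lemma prob_near_tie:
  assumes V: "0 \<le> V" "V + w \<le> U" and w: "0 \<le> w" and U: "U \<le> u" and \<mu>0: "0 \<le> \<mu>"
    and \<mu>: "\<And>l h. 0 \<le> l \<Longrightarrow> l \<le> h \<Longrightarrow> h \<le> U \<Longrightarrow> h - l \<le> 2 * w \<Longrightarrow> h powr a - l powr a \<le> \<mu>"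
    and xy: "2 \<le> \<bar>x - y\<bar>"
  shows "prob {\<omega>\<in>space M. disc y \<omega> \<le> V \<and> \<bar>disc y \<omega> - disc x \<omega>\<bar> \<le> w} \<le>
     2 * Q\<^sup>2 * V powr (2 * a) * (2 * Q\<^sup>2 * U powr a * \<mu>)"
proof -
  have ind: "indep_var borel (disc y) borel (disc x)"
    by (rule indep_vars_pair[OF indep_disc[of "{x, y}"]]) (use xy in auto)
  have S0: "0 \<le> 2 * Q\<^sup>2 * U powr a * \<mu>" using \<mu>0 by simp
  have "prob {\<omega>\<in>space M. disc y \<omega> \<le> V \<and> \<bar>disc y \<omega> - disc x \<omega>\<bar> \<le> w} \<le>
      prob {\<omega>\<in>space M. disc y \<omega> \<in> {0..V} \<and> \<bar>disc y \<omega> - disc x \<omega>\<bar> \<le> w}"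
  proof (rule finite_measure_mono_AE)
    show "AE \<omega> in M. \<omega> \<in> {\<omega>\<in>space M. disc y \<omega> \<le> V \<and> \<bar>disc y \<omega> - disc x \<omega>\<bar> \<le> w} \<longrightarrow>
      \<omega> \<in> {\<omega>\<in>space M. disc y \<omega> \<in> {0..V} \<and> \<bar>disc y \<omega> - disc x \<omega>\<bar> \<le> w}"
      using AE_F_bound[of y] AE_F_bound[of "y + 1"]
      by eventually_elim (auto simp: discrepancy_def)
  qed measurable
  also have "\<dots> \<le> prob {\<omega>\<in>space M. disc y \<omega> \<in> {0..V}} * (2 * Q\<^sup>2 * U powr a * \<mu>)"
  proof (rule prob_indep_section_le[OF ind])
    fix v assume "v \<in> {0..V}"
    then show "prob {\<omega>\<in>space M. \<bar>v - disc x \<omega>\<bar> \<le> w} \<le> 2 * Q\<^sup>2 * U powr a * \<mu>"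
      using V w U \<mu>0 \<mu> by (intro prob_disc_near) auto
  qed (use S0 in auto)
  also have "\<dots> \<le> 2 * Q\<^sup>2 * V powr (2 * a) * (2 * Q\<^sup>2 * U powr a * \<mu>)"
  proof (rule mult_right_mono[OF _ S0])
    have "prob {\<omega>\<in>space M. disc y \<omega> \<in> {0..V}} \<le> prob {\<omega>\<in>space M. disc y \<omega> \<le> V}"
      by (rule finite_measure_mono) auto
    also have "\<dots> \<le> 2 * Q\<^sup>2 * V powr (2 * a)"
      using V w U by (intro prob_disc_le) auto
    finally show "prob {\<omega>\<in>space M. disc y \<omega> \<in> {0..V}} \<le> 2 * Q\<^sup>2 * V powr (2 * a)" .
  qed
  finally show ?thesis .
qed

end

section \<open>Bounds over a window of sites or of times\<close>

lemma card_filter_eq_sum: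
  assumes "finite Y"
  shows "real (card {x\<in>Y. P x}) = (\<Sum>x\<in>Y. if P x then 1 else 0)"
  using assms by (simp add: sum.If_cases Int_def)

context sign_field_edge
begin

text \<open>The edges at even sites are independent, and \<open>1 - p \<le> exp (- p)\<close> bounds
  each factor.\<close>

lemma prob_no_small_disc:
  assumes w: "0 \<le> w" "w \<le> 2 * u" and N: "0 < N"
  shows "prob {\<omega>\<in>space M. \<forall>j<N. w < disc (2 * int j) \<omega>} \<le>
     exp (- (real N * ((q / (2 * a))\<^sup>2 * (w / 2) powr (2 * a))))"
proof -
  define p where "p = (q / (2 * a))\<^sup>2 * (w / 2) powr (2 * a)"
  define I where "I = (\<lambda>j. 2 * int j) ` {..<N}"
  have I: "finite I" "I \<noteq> {}" "card I = N"
    using N by (auto simp: I_def card_image inj_on_def)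
  have "indep_vars (\<lambda>_. borel) disc I"
    by (rule indep_disc) (auto simp: I_def)
  then have "prob (\<Inter>x\<in>I. disc x -` {w<..} \<inter> space M) = (\<Prod>x\<in>I. prob (disc x -` {w<..} \<inter> space M))"
    using I by (intro indep_varsD_finite) auto
  also have "(\<Inter>x\<in>I. disc x -` {w<..} \<inter> space M) = {\<omega>\<in>space M. \<forall>j<N. w < disc (2 * int j) \<omega>}"
    using N by (auto simp: I_def)
  also have "(\<Prod>x\<in>I. prob (disc x -` {w<..} \<inter> space M)) \<le> (\<Prod>x\<in>I. exp (- p))"
  proof (rule prod_mono, safe)
    fix x
    have "disc x -` {w<..} \<inter> space M = space M - {\<omega>\<in>space M. disc x \<omega> \<le> w}" by auto
    then have "prob (disc x -` {w<..} \<inter> space M) = 1 - prob {\<omega>\<in>space M. disc x \<omega> \<le> w}"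
      by (simp add: prob_compl)
    also have "\<dots> \<le> 1 - p" using prob_disc_ge[OF w, of x] by (simp add: p_def)
    also have "\<dots> \<le> exp (- p)" using exp_ge_add_one_self[of "- p"] by simp
    finally show "prob (disc x -` {w<..} \<inter> space M) \<le> exp (- p)" .
  qed simp
  also have "\<dots> = exp (- (real N * p))"
    using I by (simp flip: exp_of_nat_mult)
  finally show ?thesis by (simp add: p_def)
qed

lemma few_low_sites_event:
  assumes "finite Y"
  shows "{\<omega>\<in>space M. real (card {x\<in>Y. \<bar>F x \<omega>\<bar> \<le> \<theta>}) < k} \<in> events"
  unfolding card_filter_eq_sum[OF assms] by measurable

text \<open>Markov's inequality for the number \<open>Z\<close> of sites near the ends of the
  support: its mean is a small fraction of \<open>card Y\<close>, whereas the event forces at least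
  half.\<close>

lemma prob_few_low_sites:
  assumes Y: "finite Y" "Y \<noteq> {}" and w: "0 \<le> w" "w \<le> u"
  shows "prob {\<omega>\<in>space M. real (card {x\<in>Y. \<bar>F x \<omega>\<bar> \<le> c - w}) < real (card Y) / 2} \<le> 4 * Q * w powr a"
proof -
  define Z :: "'a \<Rightarrow> real" where "Z \<omega> = (\<Sum>x\<in>Y. indicator {\<omega>\<in>space M. c - w < \<bar>F x \<omega>\<bar>} \<omega>)" for \<omega>
  have R: "0 < real (card Y)" using Y by (simp add: card_gt_0_iff)
  have int: "integrable M (indicator {\<omega>\<in>space M. c - w < \<bar>F x \<omega>\<bar>} :: 'a \<Rightarrow> real)" for x
    by (intro integrable_real_indicator) (auto simp: less_top[symmetric])
  have "prob {\<omega>\<in>space M. real (card {x\<in>Y. \<bar>F x \<omega>\<bar> \<le> c - w}) < real (card Y) / 2} \<le>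
      prob {\<omega>\<in>space M. real (card Y) / 2 \<le> Z \<omega>}"
  proof (rule finite_measure_mono)
    have "real (card {x\<in>Y. \<bar>F x \<omega>\<bar> \<le> c - w}) + Z \<omega> = real (card Y)" if "\<omega> \<in> space M" for \<omega>
    proof -
      have "real (card {x\<in>Y. \<bar>F x \<omega>\<bar> \<le> c - w}) + Z \<omega> = (\<Sum>x\<in>Y. 1)"
        unfolding card_filter_eq_sum[OF Y(1)] Z_def sum.distrib[symmetric]
        by (rule sum.cong) (use that in \<open>auto simp: indicator_def\<close>)
      then show ?thesis by simp
    qed
    then show "{\<omega>\<in>space M. real (card {x\<in>Y. \<bar>F x \<omega>\<bar> \<le> c - w}) < real (card Y) / 2} \<subseteq>
        {\<omega>\<in>space M. real (card Y) / 2 \<le> Z \<omega>}"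
      by force
    show "{\<omega>\<in>space M. real (card Y) / 2 \<le> Z \<omega>} \<in> events" unfolding Z_def by measurable
  qed
  also have "\<dots> \<le> expectation Z / (real (card Y) / 2)"
    using int R by (intro integral_Markov_inequality_measure[of _ _ "{}"])
      (auto simp: Z_def[abs_def] intro!: AE_I2 sum_nonneg)
  also have "expectation Z \<le> real (card Y) * (2 * Q * w powr a)"
  proof -
    have "expectation Z = (\<Sum>x\<in>Y. prob {\<omega>\<in>space M. c - w < \<bar>F x \<omega>\<bar>})"
      unfolding Z_def[abs_def] using int by (subst Bochner_Integration.integral_sum) auto
    also have "\<dots> \<le> (\<Sum>x\<in>Y. 2 * Q * w powr a)"
    proof (rule sum_mono)
      fix x
      have "prob {\<omega>\<in>space M. c - w < \<bar>F x \<omega>\<bar>} \<le> prob {\<omega>\<in>space M. c - w \<le> \<bar>F x \<omega>\<bar>}"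
        by (rule finite_measure_mono) auto
      also have "\<dots> \<le> 2 * Q * w powr a" by (rule prob_tail_le[OF w])
      finally show "prob {\<omega>\<in>space M. c - w < \<bar>F x \<omega>\<bar>} \<le> 2 * Q * w powr a" .
    qed
    finally show ?thesis by simp
  qed
  then have "expectation Z / (real (card Y) / 2) \<le> real (card Y) * (2 * Q * w powr a) / (real (card Y) / 2)"
    using R by (intro divide_right_mono) auto
  also have "\<dots> = 4 * Q * w powr a" using R by (simp add: field_simps)
  finally show ?thesis .
qed

lemma prob_ex_small_disc:
  assumes "0 \<le> w" "w \<le> u"
  shows "prob {\<omega>\<in>space M. \<exists>x\<in>{- int N..int N}. disc x \<omega> \<le> w} \<le> (2 * real N + 1) * (2 * Q\<^sup>2 * w powr (2 * a))"
proof -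
  have "prob {\<omega>\<in>space M. \<exists>x\<in>{- int N..int N}. disc x \<omega> \<le> w} \<le> real (card {- int N..int N}) * (2 * Q\<^sup>2 * w powr (2 * a))"
    using assms by (intro prob_Bex_le prob_disc_le) auto
  also have "real (card {- int N..int N}) = 2 * real N + 1" by simp
  finally show ?thesis .
qed

lemma prob_ex_near_tie:
  assumes V: "0 \<le> V" "V + w \<le> U" and w: "0 \<le> w" and U: "U \<le> u" and \<mu>0: "0 \<le> \<mu>"
    and \<mu>: "\<And>l h. 0 \<le> l \<Longrightarrow> l \<le> h \<Longrightarrow> h \<le> U \<Longrightarrow> h - l \<le> 2 * w \<Longrightarrow> h powr a - l powr a \<le> \<mu>"
  shows "prob {\<omega>\<in>space M. \<exists>z\<in>{- int N..int N} \<times> {- int N..int N}. 2 \<le> \<bar>fst z - snd z\<bar> \<and>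
        disc (snd z) \<omega> \<le> V \<and> \<bar>disc (snd z) \<omega> - disc (fst z) \<omega>\<bar> \<le> w} \<le>
     (2 * real N + 1)\<^sup>2 * (2 * Q\<^sup>2 * V powr (2 * a) * (2 * Q\<^sup>2 * U powr a * \<mu>))"
proof -
  define I where "I = {- int N..int N}"
  have "prob {\<omega>\<in>space M. \<exists>z\<in>I \<times> I. 2 \<le> \<bar>fst z - snd z\<bar> \<and>
        disc (snd z) \<omega> \<le> V \<and> \<bar>disc (snd z) \<omega> - disc (fst z) \<omega>\<bar> \<le> w} \<le>
     real (card (I \<times> I)) * (2 * Q\<^sup>2 * V powr (2 * a) * (2 * Q\<^sup>2 * U powr a * \<mu>))"
  proof (rule prob_Bex_le)
    fix z :: "int \<times> int"
    show "prob {\<omega>\<in>space M. 2 \<le> \<bar>fst z - snd z\<bar> \<and> disc (snd z) \<omega> \<le> V \<and> \<bar>disc (snd z) \<omega> - disc (fst z) \<omega>\<bar> \<le> w}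
      \<le> 2 * Q\<^sup>2 * V powr (2 * a) * (2 * Q\<^sup>2 * U powr a * \<mu>)"
    proof (cases "2 \<le> \<bar>fst z - snd z\<bar>")
      case True
      then show ?thesis using prob_near_tie[OF V w U \<mu>0 \<mu> True] by simp
    next
      case False
      then show ?thesis using \<mu>0 by simp
    qed
  qed (auto simp: I_def)
  also have "real (card (I \<times> I)) = (2 * real N + 1)\<^sup>2"
    by (simp add: I_def card_cartesian_product power2_eq_square algebra_simps)
  finally show ?thesis by (simp add: I_def)
qed

text \<open>Three distinct sites are independent, which gives the cube.\<close>

lemma prob_ex_triple:
  assumes w: "0 \<le> w" "w \<le> u"
  shows "prob {\<omega>\<in>space M. \<exists>p\<in>{- int N..int N}. c - w < \<bar>F (p - 1) \<omega>\<bar> \<and> c - w < \<bar>F p \<omega>\<bar> \<and> c - w < \<bar>F (p + 1) \<omega>\<bar>} \<le>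
     (2 * real N + 1) * (2 * Q * w powr a) ^ 3"
proof -
  have "prob {\<omega>\<in>space M. \<exists>p\<in>{- int N..int N}. c - w < \<bar>F (p - 1) \<omega>\<bar> \<and> c - w < \<bar>F p \<omega>\<bar> \<and> c - w < \<bar>F (p + 1) \<omega>\<bar>} \<le>
     real (card {- int N..int N}) * (2 * Q * w powr a) ^ 3"
  proof (rule prob_Bex_le)
    fix p :: int
    define J where "J = {p - 1, p, p + 1}"
    define S where "S = {t::real. c - w < \<bar>t\<bar>}"
    have [measurable]: "S \<in> sets borel" unfolding S_def by measurable
    have "prob (\<Inter>i\<in>J. F i -` S \<inter> space M) = (\<Prod>i\<in>J. prob (F i -` S \<inter> space M))"
      by (rule indep_varsD[OF indep_F]) (auto simp: J_def)
    also have "\<dots> \<le> (\<Prod>i\<in>J. 2 * Q * w powr a)"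
    proof (rule prod_mono, safe)
      fix i
      have "prob (F i -` S \<inter> space M) \<le> prob {\<omega>\<in>space M. c - w \<le> \<bar>F i \<omega>\<bar>}"
        by (rule finite_measure_mono) (auto simp: S_def)
      also have "\<dots> \<le> 2 * Q * w powr a" by (rule prob_tail_le[OF w])
      finally show "prob (F i -` S \<inter> space M) \<le> 2 * Q * w powr a" .
    qed simp
    also have "\<dots> = (2 * Q * w powr a) ^ 3" by (simp add: J_def power3_eq_cube)
    also have "(\<Inter>i\<in>J. F i -` S \<inter> space M) = {\<omega>\<in>space M. c - w < \<bar>F (p - 1) \<omega>\<bar> \<and> c - w < \<bar>F p \<omega>\<bar> \<and> c - w < \<bar>F (p + 1) \<omega>\<bar>}"
      by (auto simp: J_def S_def)
    finally show "prob {\<omega>\<in>space M. c - w < \<bar>F (p - 1) \<omega>\<bar> \<and> c - w < \<bar>F p \<omega>\<bar> \<and> c - w < \<bar>F (p + 1) \<omega>\<bar>} \<le> (2 * Q * w powr a) ^ 3" .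
  qed auto
  also have "real (card {- int N..int N}) = 2 * real N + 1" by simp
  finally show ?thesis .
qed

lemma prob_ex_large_sum:
  assumes eps: "0 < \<epsilon>" and C: "0 \<le> C"
  shows "prob {\<omega>\<in>space M. \<exists>z\<in>{..Suc n} \<times> {..Suc n}. fst z < snd z \<and>
      \<epsilon> * real (snd z - fst z) + C \<le> \<bar>\<Sum>i=fst z..<snd z. B (int i) \<omega>\<bar>} \<le> (real n + 2)\<^sup>2 * (2 * exp (- 2 * \<epsilon> * C))"
proof -
  have "prob {\<omega>\<in>space M. \<exists>z\<in>{..Suc n} \<times> {..Suc n}. fst z < snd z \<and>
      \<epsilon> * real (snd z - fst z) + C \<le> \<bar>\<Sum>i=fst z..<snd z. B (int i) \<omega>\<bar>} \<le>
      real (card ({..Suc n} \<times> {..Suc n})) * (2 * exp (- 2 * \<epsilon> * C))"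
  proof (rule prob_Bex_le)
    fix z :: "nat \<times> nat"
    show "prob {\<omega>\<in>space M. fst z < snd z \<and> \<epsilon> * real (snd z - fst z) + C \<le> \<bar>\<Sum>i=fst z..<snd z. B (int i) \<omega>\<bar>}
      \<le> 2 * exp (- 2 * \<epsilon> * C)"
    proof (cases "fst z < snd z")
      case True
      define I where "I = int ` {fst z..<snd z}"
      have I: "finite I" "I \<noteq> {}" "card I = snd z - fst z"
        using True by (auto simp: I_def card_image)
      have "(\<Sum>i=fst z..<snd z. B (int i) \<omega>) = (\<Sum>i\<in>I. B i \<omega>)" for \<omega>
        by (simp add: I_def sum.reindex)
      then show ?thesis using prob_sign_sum_ge[OF I(1,2) eps C] I(3) True by simp
    next
      case False
      then show ?thesis by simp
    qed
  qed auto
  also have "real (card ({..Suc n} \<times> {..Suc n})) = (real n + 2)\<^sup>2"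
    by (simp add: card_cartesian_product power2_eq_square algebra_simps)
  finally show ?thesis .
qed

end

section \<open>Asymptotics\<close>

lemma ex_small_powr:
  fixes b M e m :: real
  assumes "0 < b" "0 \<le> M" "0 < e" "0 < m"
  shows "\<exists>k>0. k \<le> m \<and> M * k powr b \<le> e"
proof -
  define k where "k = min m ((e / (M + 1)) powr (1 / b))"
  have k: "0 < k" "k \<le> m" using assms by (auto simp: k_def)
  have "k powr b \<le> ((e / (M + 1)) powr (1 / b)) powr b"
    using k assms by (intro powr_mono2) (auto simp: k_def)
  also have "\<dots> = e / (M + 1)" using assms by (simp add: powr_powr)
  finally have "M * k powr b \<le> M * (e / (M + 1))" using assms by (intro mult_left_mono) auto
  also have "\<dots> \<le> e" using assms by (simp add: field_simps)
  finally show ?thesis using k by blast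
qed

text \<open>Uniform continuity on a compact interval covers all positive exponents, including those
  below 1.\<close>

lemma powr_modulus:
  fixes b K \<mu> :: real
  assumes "0 < b" "0 < \<mu>"
  shows "\<exists>\<eta>>0. \<forall>l h. 0 \<le> l \<longrightarrow> l \<le> h \<longrightarrow> h \<le> K \<longrightarrow> h - l \<le> 2 * \<eta> \<longrightarrow> h powr b - l powr b \<le> \<mu>"
proof -
  have "uniformly_continuous_on {0..K} (\<lambda>x. x powr b)"
    using assms by (intro compact_uniformly_continuous continuous_on_powr' continuous_intros) auto
  then obtain d where d: "0 < d" "\<And>x y. x \<in> {0..K} \<Longrightarrow> y \<in> {0..K} \<Longrightarrow> dist y x < d \<Longrightarrow> dist (y powr b) (x powr b) < \<mu>"
    using assms unfolding uniformly_continuous_on_def by metis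
  show ?thesis
  proof (intro exI[of _ "d / 4"] conjI allI impI)
    fix l h assume *: "0 \<le> l" "l \<le> h" "h \<le> K" "h - l \<le> 2 * (d / 4)"
    then have "dist (h powr b) (l powr b) < \<mu>"
      using d(1) by (intro d(2)) (auto simp: dist_real_def)
    then show "h powr b - l powr b \<le> \<mu>" by (simp add: dist_real_def)
  qed (use d in auto)
qed

context sign_field_edge
begin

text \<open>The exponent balances two scales: \<open>\<delta> n * n = n powr \<zeta>\<close> equates
  staying cost with travel cost, and \<open>\<delta> n powr (2 * a) = n powr (- \<zeta>)\<close>
  makes the expected number of edges below \<open>\<delta> n\<close> among
  \<open>n powr \<zeta>\<close> sites of order one.\<close>

definition \<zeta> :: real where "\<zeta> = 2 * a / (2 * a + 1)"

definition \<delta> :: "nat \<Rightarrow> real" where "\<delta> n = real n powr (\<zeta> - 1)"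

lemma zeta: "0 < \<zeta>" "\<zeta> < 1" "(\<zeta> - 1) * (2 * a) = - \<zeta>"
  using a_pos by (auto simp: \<zeta>_def field_simps)

lemma delta_pos: "0 < n \<Longrightarrow> 0 < \<delta> n"
  by (simp add: \<delta>_def)

lemma delta_mult: "\<delta> n * real n = real n powr \<zeta>"
  using powr_mult_base[of "real n" "\<zeta> - 1"] by (simp add: \<delta>_def mult.commute)

lemma delta_powr: "\<delta> n powr (2 * a) = real n powr (- \<zeta>)"
  by (simp only: \<delta>_def powr_powr zeta)

lemma delta_powr_scaled: "0 \<le> k \<Longrightarrow> (k * \<delta> n) powr (2 * a) = k powr (2 * a) * real n powr (- \<zeta>)"
  by (simp only: powr_mult delta_powr)

lemma delta_tendsto: "\<delta> \<longlonglongrightarrow> 0"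
  unfolding \<delta>_def using zeta
  by (intro tendsto_neg_powr filterlim_real_sequentially) auto

lemma delta_le: "0 < e \<Longrightarrow> \<forall>\<^sub>F n in sequentially. K * \<delta> n \<le> e"
  using order_tendstoD(2)[OF tendsto_mult_right_zero[OF delta_tendsto, of K], of e]
  by (auto elim!: eventually_mono)

lemma powr_zeta_ge: "\<forall>\<^sub>F n in sequentially. K \<le> real n powr \<zeta>"
proof -
  have "filterlim (\<lambda>n. real n powr \<zeta>) at_top sequentially" using zeta(1) by real_asymp
  then show ?thesis by (simp add: filterlim_at_top)
qed

lemma powr_zeta_cancel: "0 < n \<Longrightarrow> real n powr \<zeta> * real n powr (- \<zeta>) = 1"
  by (simp flip: powr_add)

text \<open>About half of the \<open>n powr \<zeta>\<close> sites are even, and each carries a small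
  discrepancy with probability at least a multiple of \<open>n powr (- \<zeta>)\<close>. The
  expected number is therefore constant in \<open>n\<close> and grows with \<open>K\<close>.\<close>

lemma good_edge_exists:
  assumes e: "0 < e"
  shows "\<exists>K>0. \<forall>\<^sub>F n in sequentially.
    prob {\<omega>\<in>space M. \<forall>j<nat \<lceil>real n powr \<zeta> / 2\<rceil>. K * \<delta> n < disc (2 * int j) \<omega>} \<le> e"
proof -
  define c0 where "c0 = (q / (2 * a))\<^sup>2"
  have c0: "0 < c0" using q_pos a_pos by (simp add: c0_def)
  define T where "T = 2 * \<bar>ln e\<bar> / c0 + 1"
  have T: "0 < T" using c0 by (auto simp: T_def intro!: add_nonneg_pos)
  \<comment> \<open>The factor 2 cancels the halving of the threshold in
    \<open>prob_disc_ge\<close>, and \<open>T\<close> was chosen so that the exponent is below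
    \<open>ln e\<close>.\<close>
  define K where "K = 2 * T powr (1 / (2 * a))"
  have K: "0 < K" "(K / 2) powr (2 * a) = T" using T a_pos by (auto simp: K_def powr_powr)
  have "c0 * T / 2 = \<bar>ln e\<bar> + c0 / 2" using c0 by (simp add: T_def field_simps)
  then have "- (c0 * T / 2) \<le> ln e" using c0 by linarith
  then have exp: "exp (- (c0 * T / 2)) \<le> e" using e by (metis exp_le_cancel_iff exp_ln)
  have "0 < 2 * u" using u_pos by simp
  from delta_le[OF this, of K] eventually_gt_at_top[of 0]
  have "\<forall>\<^sub>F n in sequentially.
    prob {\<omega>\<in>space M. \<forall>j<nat \<lceil>real n powr \<zeta> / 2\<rceil>. K * \<delta> n < disc (2 * int j) \<omega>} \<le> e"
  proof eventually_elim
    case (elim n)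
    define N where "N = nat \<lceil>real n powr \<zeta> / 2\<rceil>"
    have N: "real n powr \<zeta> / 2 \<le> real N" "0 < N" using elim by (auto simp: N_def)
    have "(K * \<delta> n / 2) powr (2 * a) = T * real n powr (- \<zeta>)"
      using delta_powr_scaled[of "K / 2" n] K by (simp add: mult_ac)
    then have "prob {\<omega>\<in>space M. \<forall>j<N. K * \<delta> n < disc (2 * int j) \<omega>} \<le> exp (- (real N * (c0 * (T * real n powr (- \<zeta>)))))"
      using prob_no_small_disc[of "K * \<delta> n" N] elim N K delta_pos[of n] by (simp add: c0_def)
    also have "\<dots> \<le> exp (- (c0 * T / 2))"
    proof -
      have "c0 * T / 2 = real n powr \<zeta> / 2 * (c0 * (T * real n powr (- \<zeta>)))"
        using powr_zeta_cancel[of n] elim by (simp add: mult_ac)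
      also have "\<dots> \<le> real N * (c0 * (T * real n powr (- \<zeta>)))"
        using N c0 T by (intro mult_right_mono) auto
      finally show ?thesis by simp
    qed
    finally show ?case using exp by (simp add: N_def)
  qed
  then show ?thesis using K by blast
qed

text \<open>First moment: the powers of \<open>n\<close> cancel and the constant
  \<open>k powr (2 * a)\<close> can be made small.\<close>

lemma no_small_disc_wide:
  assumes e: "0 < e" and K: "0 \<le> K"
  shows "\<exists>k>0. \<forall>\<^sub>F n in sequentially. \<forall>N. real N \<le> K * real n powr \<zeta> \<longrightarrow>
    prob {\<omega>\<in>space M. \<exists>x\<in>{- int N..int N}. disc x \<omega> \<le> k * \<delta> n} \<le> e"
proof -
  obtain k where k: "0 < k" "(2 * K + 1) * (2 * Q\<^sup>2) * k powr (2 * a) \<le> e"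
    using ex_small_powr[of "2 * a" "(2 * K + 1) * (2 * Q\<^sup>2)" e 1] a_pos K e by auto
  from delta_le[OF u_pos, of k] powr_zeta_ge[of 1] eventually_gt_at_top[of 0]
  have "\<forall>\<^sub>F n in sequentially. \<forall>N. real N \<le> K * real n powr \<zeta> \<longrightarrow>
    prob {\<omega>\<in>space M. \<exists>x\<in>{- int N..int N}. disc x \<omega> \<le> k * \<delta> n} \<le> e"
  proof eventually_elim
    case (elim n)
    show ?case
    proof (intro allI impI)
      fix N assume N: "real N \<le> K * real n powr \<zeta>"
      have "prob {\<omega>\<in>space M. \<exists>x\<in>{- int N..int N}. disc x \<omega> \<le> k * \<delta> n} \<le>
          (2 * real N + 1) * (2 * Q\<^sup>2 * (k powr (2 * a) * real n powr (- \<zeta>)))"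
        using prob_ex_small_disc[of "k * \<delta> n" N] elim k delta_pos[of n] by (simp add: delta_powr_scaled)
      also have "\<dots> \<le> ((2 * K + 1) * real n powr \<zeta>) * (2 * Q\<^sup>2 * (k powr (2 * a) * real n powr (- \<zeta>)))"
        using N elim by (intro mult_right_mono) (auto simp: algebra_simps)
      also have "\<dots> = (2 * K + 1) * (2 * Q\<^sup>2) * k powr (2 * a) * (real n powr \<zeta> * real n powr (- \<zeta>))"
        by (simp add: mult_ac)
      finally show "prob {\<omega>\<in>space M. \<exists>x\<in>{- int N..int N}. disc x \<omega> \<le> k * \<delta> n} \<le> e"
        using powr_zeta_cancel[of n] elim k by simp
    qed
  qed
  then show ?thesis using k by blast
qed

text \<open>The same first moment with a given threshold and a shrinking window. The summand 1 in
  \<open>2 * N + 1\<close> does not shrink with \<open>k\<close>; large \<open>n\<close> takes care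
  of it.\<close>

lemma no_small_disc_narrow:
  assumes e: "0 < e" and K: "0 \<le> K"
  shows "\<exists>k>0. \<forall>\<^sub>F n in sequentially. \<forall>N. real N \<le> k * real n powr \<zeta> \<longrightarrow>
    prob {\<omega>\<in>space M. \<exists>x\<in>{- int N..int N}. disc x \<omega> \<le> K * \<delta> n} \<le> e"
proof -
  define D where "D = 2 * Q\<^sup>2 * K powr (2 * a)"
  have D: "0 \<le> D" by (simp add: D_def)
  define k where "k = e / (4 * (D + 1))"
  have k: "0 < k" "2 * k * D \<le> e / 2" using D e by (auto simp: k_def field_simps)
  from delta_le[OF u_pos, of K] powr_zeta_ge[of "2 * D / e"] eventually_gt_at_top[of 0]
  have "\<forall>\<^sub>F n in sequentially. \<forall>N. real N \<le> k * real n powr \<zeta> \<longrightarrow>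
    prob {\<omega>\<in>space M. \<exists>x\<in>{- int N..int N}. disc x \<omega> \<le> K * \<delta> n} \<le> e"
  proof eventually_elim
    case (elim n)
    show ?case
    proof (intro allI impI)
      fix N assume N: "real N \<le> k * real n powr \<zeta>"
      have "prob {\<omega>\<in>space M. \<exists>x\<in>{- int N..int N}. disc x \<omega> \<le> K * \<delta> n} \<le>
          (2 * real N + 1) * (2 * Q\<^sup>2 * (K * \<delta> n) powr (2 * a))"
        using elim K delta_pos[of n] by (intro prob_ex_small_disc) auto
      also have "2 * Q\<^sup>2 * (K * \<delta> n) powr (2 * a) = D * real n powr (- \<zeta>)"
        by (simp add: delta_powr_scaled[OF K] D_def)
      also have "(2 * real N + 1) * (D * real n powr (- \<zeta>)) \<le> (2 * (k * real n powr \<zeta>) + 1) * (D * real n powr (- \<zeta>))"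
        using N D by (intro mult_right_mono) auto
      also have "\<dots> = 2 * k * D * (real n powr \<zeta> * real n powr (- \<zeta>)) + D * real n powr (- \<zeta>)"
        by (simp add: algebra_simps)
      also have "\<dots> \<le> e / 2 + e / 2"
      proof (rule add_mono)
        show "2 * k * D * (real n powr \<zeta> * real n powr (- \<zeta>)) \<le> e / 2"
          using powr_zeta_cancel[of n] elim k by simp
        have "0 < real n powr \<zeta>" using elim by simp
        then show "D * real n powr (- \<zeta>) \<le> e / 2"
          using elim e by (simp add: powr_minus field_simps)
      qed
      finally show "prob {\<omega>\<in>space M. \<exists>x\<in>{- int N..int N}. disc x \<omega> \<le> K * \<delta> n} \<le> e" by simp
    qed
  qed
  then show ?thesis using k by blast
qed

text \<open>There are of order \<open>n powr (2 * \<zeta>)\<close> pairs, and each tie has a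
  probability of order \<open>\<mu> * n powr (- 2 * \<zeta>)\<close>. Choosing \<open>\<eta>\<close>
  small makes the modulus \<open>\<mu>\<close> small.\<close>

lemma no_near_tie:
  assumes e: "0 < e" and K: "0 \<le> K" and V: "0 \<le> V"
  shows "\<exists>\<eta>>0. \<forall>\<^sub>F n in sequentially. \<forall>N. real N \<le> K * real n powr \<zeta> \<longrightarrow>
    prob {\<omega>\<in>space M. \<exists>z\<in>{- int N..int N} \<times> {- int N..int N}. 2 \<le> \<bar>fst z - snd z\<bar> \<and>
        disc (snd z) \<omega> \<le> V * \<delta> n \<and> \<bar>disc (snd z) \<omega> - disc (fst z) \<omega>\<bar> \<le> \<eta> * \<delta> n} \<le> e"
proof -
  define D where "D = (2 * K + 1)\<^sup>2 * (2 * Q\<^sup>2 * V powr (2 * a) * (2 * Q\<^sup>2 * (V + 1) powr a))"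
  have D: "0 \<le> D" by (simp add: D_def)
  define \<mu> where "\<mu> = e / (D + 1)"
  have \<mu>: "0 < \<mu>" "D * \<mu> \<le> e" using D e by (auto simp: \<mu>_def field_simps)
  obtain \<eta>' where \<eta>': "0 < \<eta>'" "\<And>l h. 0 \<le> l \<Longrightarrow> l \<le> h \<Longrightarrow> h \<le> V + 1 \<Longrightarrow> h - l \<le> 2 * \<eta>' \<Longrightarrow> h powr a - l powr a \<le> \<mu>"
    using powr_modulus[OF a_pos \<mu>(1), of "V + 1"] by metis
  define \<eta> where "\<eta> = min 1 \<eta>'"
  have \<eta>: "0 < \<eta>" "\<eta> \<le> 1" "\<eta> \<le> \<eta>'" using \<eta>' by (auto simp: \<eta>_def)
  from delta_le[OF u_pos, of "V + 1"] powr_zeta_ge[of 1] eventually_gt_at_top[of 0]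
  have "\<forall>\<^sub>F n in sequentially. \<forall>N. real N \<le> K * real n powr \<zeta> \<longrightarrow>
    prob {\<omega>\<in>space M. \<exists>z\<in>{- int N..int N} \<times> {- int N..int N}. 2 \<le> \<bar>fst z - snd z\<bar> \<and>
        disc (snd z) \<omega> \<le> V * \<delta> n \<and> \<bar>disc (snd z) \<omega> - disc (fst z) \<omega>\<bar> \<le> \<eta> * \<delta> n} \<le> e"
  proof eventually_elim
    case (elim n)
    have d: "0 < \<delta> n" using elim delta_pos by simp
    show ?case
    proof (intro allI impI)
      fix N assume N: "real N \<le> K * real n powr \<zeta>"
      \<comment> \<open>Dividing by \<open>\<delta> n\<close> moves the modulus from the fixed
        interval up to \<open>V + 1\<close> to the shrinking one, by homogeneity of powers.\<close>
      have mod: "h powr a - l powr a \<le> \<mu> * \<delta> n powr a"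
        if "0 \<le> l" "l \<le> h" "h \<le> (V + 1) * \<delta> n" "h - l \<le> 2 * (\<eta> * \<delta> n)" for l h
      proof -
        have "h - l \<le> 2 * \<eta>' * \<delta> n"
          using that(4) mult_right_mono[OF \<eta>(3), of "\<delta> n"] d by linarith
        then have "(h / \<delta> n) powr a - (l / \<delta> n) powr a \<le> \<mu>"
          using that d by (intro \<eta>') (auto simp: field_simps)
        then have "((h / \<delta> n) powr a - (l / \<delta> n) powr a) * \<delta> n powr a \<le> \<mu> * \<delta> n powr a"
          by (intro mult_right_mono) auto
        moreover have "(h / \<delta> n) powr a * \<delta> n powr a = h powr a" "(l / \<delta> n) powr a * \<delta> n powr a = l powr a"
          using that d by (auto simp flip: powr_mult)
        ultimately show ?thesis by (simp add: algebra_simps)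
      qed
      have Vw: "V * \<delta> n + \<eta> * \<delta> n \<le> (V + 1) * \<delta> n"
        using \<eta> d by (simp add: algebra_simps)
      have "prob {\<omega>\<in>space M. \<exists>z\<in>{- int N..int N} \<times> {- int N..int N}. 2 \<le> \<bar>fst z - snd z\<bar> \<and>
        disc (snd z) \<omega> \<le> V * \<delta> n \<and> \<bar>disc (snd z) \<omega> - disc (fst z) \<omega>\<bar> \<le> \<eta> * \<delta> n} \<le>
        (2 * real N + 1)\<^sup>2 * (2 * Q\<^sup>2 * (V * \<delta> n) powr (2 * a) * (2 * Q\<^sup>2 * ((V + 1) * \<delta> n) powr a * (\<mu> * \<delta> n powr a)))"
        by (rule prob_ex_near_tie[OF _ Vw _ _ _ mod]) (use V \<eta> d \<mu> elim in auto)
      also have "\<dots> \<le> ((2 * K + 1) * real n powr \<zeta>)\<^sup>2 * (2 * Q\<^sup>2 * (V * \<delta> n) powr (2 * a) * (2 * Q\<^sup>2 * ((V + 1) * \<delta> n) powr a * (\<mu> * \<delta> n powr a)))"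
        using N elim \<mu> by (intro mult_right_mono power_mono) (auto simp: algebra_simps)
      also have "\<dots> = D * \<mu> * (real n powr \<zeta> * real n powr (- \<zeta>))\<^sup>2"
      proof -
        have "\<delta> n powr a * \<delta> n powr a = real n powr (- \<zeta>)"
          using delta_powr[of n] by (simp flip: powr_add)
        then show ?thesis
          using V d delta_powr[of n] by (simp add: delta_powr_scaled powr_mult D_def power_mult_distrib power2_eq_square mult_ac)
      qed
      finally show "prob {\<omega>\<in>space M. \<exists>z\<in>{- int N..int N} \<times> {- int N..int N}. 2 \<le> \<bar>fst z - snd z\<bar> \<and>
        disc (snd z) \<omega> \<le> V * \<delta> n \<and> \<bar>disc (snd z) \<omega> - disc (fst z) \<omega>\<bar> \<le> \<eta> * \<delta> n} \<le> e"
        using powr_zeta_cancel[of n] elim \<mu> by simp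
    qed
  qed
  then show ?thesis using \<eta> by blast
qed

section \<open>High sites and partial sums of signs\<close>

text \<open>The exponent of \<open>height\<close> lies between \<open>2/3\<close> and \<open>1\<close> times that of \<open>\<delta>\<close>: above \<open>2/3\<close>
  triples of high sites disappear, below \<open>1\<close> there is room for a factor \<open>slack\<close> between
  \<open>\<delta>\<close> and \<open>height\<close>.\<close>
definition height :: "nat \<Rightarrow> real" where "height n = real n powr ((\<zeta> - 1) * (5/6))"

definition slack :: "nat \<Rightarrow> real" where "slack n = real n powr ((1 - \<zeta>) / 12)"

lemma height_le: "0 < e \<Longrightarrow> \<forall>\<^sub>F n in sequentially. height n \<le> e"
proof -
  assume "0 < e"
  have "height \<longlonglongrightarrow> 0"
    unfolding height_def using zeta
    by (intro tendsto_neg_powr filterlim_real_sequentially) (auto simp: mult_neg_pos)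
  from order_tendstoD(2)[OF this \<open>0 < e\<close>] show ?thesis by (auto elim!: eventually_mono)
qed

lemma slack_le: "\<forall>\<^sub>F n in sequentially. slack n \<le> real n / 4"
proof -
  have "((\<lambda>n. real n powr ((1 - \<zeta>) / 12 - 1)) \<longlongrightarrow> 0) sequentially"
    using zeta by (intro tendsto_neg_powr filterlim_real_sequentially) auto
  then have "\<forall>\<^sub>F n in sequentially. real n powr ((1 - \<zeta>) / 12 - 1) < 1/4"
    by (rule order_tendstoD) simp
  with eventually_gt_at_top[of 0] show ?thesis
  proof eventually_elim
    case (elim n)
    have "slack n = real n * real n powr ((1 - \<zeta>) / 12 - 1)"
      using powr_mult_base[of "real n" "(1 - \<zeta>) / 12 - 1"] by (simp add: slack_def)
    also have "\<dots> \<le> real n * (1/4)" using elim by (intro mult_left_mono) auto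
    finally show ?case by simp
  qed
qed

text \<open>Supplies the condition on \<open>h\<close> in the deterministic estimates, with
  \<open>slack\<close> in the place of the allowance \<open>C\<close>.\<close>

lemma delta_slack_less_height: "\<forall>\<^sub>F n in sequentially. K * \<delta> n * (slack n + 1) < height n"
proof -
  have 1: "((\<lambda>n. real n powr ((\<zeta> - 1) / 12)) \<longlongrightarrow> 0) sequentially"
    "((\<lambda>n. real n powr ((\<zeta> - 1) / 6)) \<longlongrightarrow> 0) sequentially"
    using zeta by (intro tendsto_neg_powr filterlim_real_sequentially; simp)+
  have "((\<lambda>n. K * (real n powr ((\<zeta> - 1) / 12) + real n powr ((\<zeta> - 1) / 6))) \<longlongrightarrow> K * (0 + 0)) sequentially"
    by (intro tendsto_intros 1)
  then have "\<forall>\<^sub>F n in sequentially. K * (real n powr ((\<zeta> - 1) / 12) + real n powr ((\<zeta> - 1) / 6)) < 1"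
    by (rule order_tendstoD) simp
  with eventually_gt_at_top[of 0] show ?thesis
  proof eventually_elim
    case (elim n)
    have "\<zeta> - 1 + (1 - \<zeta>) / 12 = (\<zeta> - 1) * (5/6) + (\<zeta> - 1) / 12"
      "\<zeta> - 1 = (\<zeta> - 1) * (5/6) + (\<zeta> - 1) / 6"
      by (simp_all add: field_simps)
    then have "\<delta> n * slack n = height n * real n powr ((\<zeta> - 1) / 12)"
      "\<delta> n = height n * real n powr ((\<zeta> - 1) / 6)"
      by (simp_all only: \<delta>_def slack_def height_def powr_add[symmetric])
    then have "K * \<delta> n * (slack n + 1) = height n * (K * (real n powr ((\<zeta> - 1) / 12) + real n powr ((\<zeta> - 1) / 6)))"
      by (simp add: algebra_simps)
    also have "\<dots> < height n * 1"
      using elim by (intro mult_strict_left_mono) (auto simp: height_def)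
    finally show ?case by simp
  qed
qed

text \<open>First moment again: \<open>n powr \<zeta>\<close> centres times
  \<open>height n powr (3 * a)\<close> is \<open>n powr (- \<zeta> / 4)\<close>, which
  vanishes.\<close>

lemma no_triple:
  assumes e: "0 < e" and K: "0 \<le> K"
  shows "\<forall>\<^sub>F n in sequentially. \<forall>N. real N \<le> K * real n powr \<zeta> \<longrightarrow>
    prob {\<omega>\<in>space M. \<exists>p\<in>{- int N..int N}. c - height n < \<bar>F (p - 1) \<omega>\<bar> \<and> c - height n < \<bar>F p \<omega>\<bar> \<and>
      c - height n < \<bar>F (p + 1) \<omega>\<bar>} \<le> e"
proof -
  have "((\<lambda>n. (2 * K + 1) * (2 * Q) ^ 3 * real n powr (- \<zeta> / 4)) \<longlongrightarrow> (2 * K + 1) * (2 * Q) ^ 3 * 0) sequentially"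
    using zeta by (intro tendsto_mult_left tendsto_neg_powr filterlim_real_sequentially) auto
  then have "\<forall>\<^sub>F n in sequentially. (2 * K + 1) * (2 * Q) ^ 3 * real n powr (- \<zeta> / 4) < e"
    using e by (intro order_tendstoD) auto
  with height_le[OF u_pos] powr_zeta_ge[of 1] eventually_gt_at_top[of 0] show ?thesis
  proof eventually_elim
    case (elim n)
    show ?case
    proof (intro allI impI)
      fix N assume N: "real N \<le> K * real n powr \<zeta>"
      have h0: "0 \<le> height n" by (simp add: height_def)
      have "prob {\<omega>\<in>space M. \<exists>p\<in>{- int N..int N}. c - height n < \<bar>F (p - 1) \<omega>\<bar> \<and> c - height n < \<bar>F p \<omega>\<bar> \<and>
        c - height n < \<bar>F (p + 1) \<omega>\<bar>} \<le> (2 * real N + 1) * (2 * Q * height n powr a) ^ 3"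
        by (rule prob_ex_triple) (use h0 elim in auto)
      also have "\<dots> \<le> ((2 * K + 1) * real n powr \<zeta>) * (2 * Q * height n powr a) ^ 3"
        using N elim Q_pos by (intro mult_right_mono) (auto simp: algebra_simps)
      also have "\<dots> = (2 * K + 1) * (2 * Q) ^ 3 * (real n powr \<zeta> * (height n powr a) ^ 3)"
        by (simp add: power_mult_distrib)
      also have "real n powr \<zeta> * (height n powr a) ^ 3 = real n powr (- \<zeta> / 4)"
      proof -
        \<comment> \<open>Since \<open>3 * a * 5/6\<close> is \<open>5/4\<close> times
          \<open>2 * a\<close>, the defining relation of \<open>\<zeta>\<close> applies.\<close>
        have ex: "(\<zeta> - 1) * (5/6) * a * 3 = - (5/4) * \<zeta>" using zeta(3) by (simp add: algebra_simps)
        have "(height n powr a) ^ 3 = (height n powr a) powr 3"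
          using elim by (simp add: height_def powr_numeral)
        also have "\<dots> = real n powr (- (5/4) * \<zeta>)"
          by (simp only: height_def powr_powr ex)
        finally show ?thesis by (simp flip: powr_add)
      qed
      finally show "prob {\<omega>\<in>space M. \<exists>p\<in>{- int N..int N}. c - height n < \<bar>F (p - 1) \<omega>\<bar> \<and> c - height n < \<bar>F p \<omega>\<bar> \<and>
        c - height n < \<bar>F (p + 1) \<omega>\<bar>} \<le> e" using elim by linarith
    qed
  qed
qed

text \<open>The number of time intervals is polynomial in \<open>n\<close>, while
  \<open>slack\<close> is a positive power of \<open>n\<close> in the exponent.\<close>

lemma no_large_sum:
  assumes e: "0 < e" and eps: "0 < \<epsilon>"
  shows "\<forall>\<^sub>F n in sequentially. prob {\<omega>\<in>space M. \<exists>z\<in>{..Suc n} \<times> {..Suc n}. fst z < snd z \<and>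
      \<epsilon> * real (snd z - fst z) + slack n \<le> \<bar>\<Sum>i=fst z..<snd z. B (int i) \<omega>\<bar>} \<le> e"
proof -
  have "((\<lambda>n. (real n + 2)\<^sup>2 * (2 * exp (- 2 * \<epsilon> * slack n))) \<longlongrightarrow> 0) sequentially"
  proof -
    define s where "s = (1 - \<zeta>) / 12"
    have "0 < s" using zeta by (simp add: s_def)
    then show ?thesis unfolding slack_def s_def[symmetric] using eps by real_asymp
  qed
  from order_tendstoD(2)[OF this e] show ?thesis
  proof eventually_elim
    case (elim n)
    have "0 \<le> slack n" by (simp add: slack_def)
    then show ?case using prob_ex_large_sum[OF eps, of "slack n" n] elim by linarith
  qed
qed

end

section \<open>The good event\<close>

lemma (in sign_field) ex_sign_field_edge:
  obtains u where "sign_field_edge M F B \<rho> c q \<kappa> u"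
proof (rule edge_law)
  fix u
  assume u: "0 < u"
    and up: "\<And>x \<sigma> v w. \<sigma> = 1 \<or> \<sigma> = -1 \<Longrightarrow> 0 \<le> v \<Longrightarrow> v \<le> w \<Longrightarrow> w \<le> u \<Longrightarrow>
      prob {\<omega>\<in>space M. c - \<sigma> * F x \<omega> \<in> {v..w}} \<le> 2 * q / a * (w powr a - v powr a)"
    and low: "\<And>x \<sigma> w. \<sigma> = 1 \<or> \<sigma> = -1 \<Longrightarrow> 0 \<le> w \<Longrightarrow> w \<le> u \<Longrightarrow>
      q / (2 * a) * w powr a \<le> prob {\<omega>\<in>space M. c - \<sigma> * F x \<omega> \<in> {0..w}}"
  have "sign_field_edge M F B \<rho> c q \<kappa> u"
    by (intro sign_field_edge.intro sign_field_edge_axioms.intro sign_field_axioms u)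
       (fact up, fact low)
  then show thesis by (rule that)
qed

context sign_field_edge
begin

text \<open>Eight bad events, each of probability at most \<open>\<epsilon>0 / 8\<close>, are
  excluded. Quantifying over all optimal walks and minimizers inside \<open>E\<close> keeps the
  event measurable whatever selection is made later.\<close>

lemma good_event:
  assumes \<epsilon>0: "0 < \<epsilon>0"
  shows "\<exists>k1 k2. 0 < k1 \<and> k1 < k2 \<and> (\<forall>\<^sub>F n in sequentially. \<exists>E\<in>events. 1 - \<epsilon>0 \<le> prob E \<and>
    (\<forall>\<omega>\<in>E. \<forall>\<gamma> l. optimal_walk (\<lambda>i. B i \<omega>) (\<lambda>x. F x \<omega>) n \<gamma> \<longrightarrow> l \<in> \<gamma> ` {0..n} \<longrightarrow>
      (\<forall>x\<in>\<gamma> ` {0..n}. disc l \<omega> \<le> disc x \<omega>) \<longrightarrow>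
      (\<forall>i. hit_time \<gamma> l \<le> i \<and> i \<le> n \<longrightarrow> \<gamma> i \<in> {l, l + 1}) \<and>
      k1 * real n powr \<zeta> \<le> real_of_int \<bar>l\<bar> \<and> real_of_int \<bar>l\<bar> \<le> k2 * real n powr \<zeta> \<and>
      k1 * \<delta> n \<le> disc l \<omega> \<and> disc l \<omega> \<le> k2 * \<delta> n \<and>
      k1 * real n powr \<zeta> \<le> c * real n + action (\<lambda>i. B i \<omega>) (\<lambda>x. F x \<omega>) n \<gamma> \<and>
      c * real n + action (\<lambda>i. B i \<omega>) (\<lambda>x. F x \<omega>) n \<gamma> \<le> k2 * real n powr \<zeta>))"
proof -
  define e where "e = \<epsilon>0 / 8"
  have e: "0 < e" using \<epsilon>0 by (simp add: e_def)
  define b1 where "b1 K n = {\<omega>\<in>space M. \<forall>j<nat \<lceil>real n powr \<zeta> / 2\<rceil>. K * \<delta> n < disc (2 * int j) \<omega>}" for K n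
  define b2 where "b2 w Y = {\<omega>\<in>space M. real (card {x\<in>Y. \<bar>F x \<omega>\<bar> \<le> c - w}) < real (card Y) / 2}" for w Y
  define b3 where "b3 k N n = {\<omega>\<in>space M. \<exists>x\<in>{- int N..int N}. disc x \<omega> \<le> k * \<delta> n}" for k N n
  define b4 where "b4 V \<eta> N n = {\<omega>\<in>space M. \<exists>z\<in>{- int N..int N} \<times> {- int N..int N}. 2 \<le> \<bar>fst z - snd z\<bar> \<and>
        disc (snd z) \<omega> \<le> V * \<delta> n \<and> \<bar>disc (snd z) \<omega> - disc (fst z) \<omega>\<bar> \<le> \<eta> * \<delta> n}" for V \<eta> N n
  define b5 where "b5 N n = {\<omega>\<in>space M. \<exists>p\<in>{- int N..int N}. c - height n < \<bar>F (p - 1) \<omega>\<bar> \<and>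
      c - height n < \<bar>F p \<omega>\<bar> \<and> c - height n < \<bar>F (p + 1) \<omega>\<bar>}" for N n
  define b6 where "b6 \<epsilon> n = {\<omega>\<in>space M. \<exists>z\<in>{..Suc n} \<times> {..Suc n}. fst z < snd z \<and>
      \<epsilon> * real (snd z - fst z) + slack n \<le> \<bar>\<Sum>i=fst z..<snd z. B (int i) \<omega>\<bar>}" for \<epsilon> n
  have bad_events: "b1 K n \<in> events" "finite Y \<Longrightarrow> b2 w Y \<in> events" "b3 k N n \<in> events"
    "b4 V \<eta> N n \<in> events" "b5 N n \<in> events" "b6 \<epsilon> n \<in> events" for K w k V \<eta> \<epsilon> N n Y
    unfolding b1_def b3_def b4_def b5_def b6_def b2_def using few_low_sites_event by (measurable; simp)+

  \<comment> \<open>The constants depend on each other in this order: \<open>K1\<close> fixes the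
    cost constant \<open>A\<close>, \<open>w\<close> and \<open>A\<close> fix the window
    \<open>K\<close>, then come \<open>k3\<close>, \<open>k4\<close> and \<open>\<eta>\<close>, and
    \<open>\<epsilon>\<close> last.\<close>
  obtain K1 where K1: "0 < K1" and ev1: "\<forall>\<^sub>F n in sequentially. prob (b1 K1 n) \<le> e"
    using good_edge_exists[OF e] unfolding b1_def by blast
  obtain w where w: "0 < w" "w \<le> u" "4 * Q * w powr a \<le> e"
    using ex_small_powr[OF a_pos _ e u_pos, of "4 * Q"] Q_pos by auto
  define A where "A = 2 * c + K1"
  have A: "0 < A" using c_pos K1 by (simp add: A_def)
  \<comment> \<open>The radius \<open>R\<close> must exceed \<open>2 * A / w\<close> times
    \<open>n powr \<zeta>\<close>; one unit makes the inequality strict and another absorbs the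
    rounding.\<close>
  define K where "K = 2 * A / w + 2"
  have K: "0 < K" using A w by (auto simp: K_def intro!: add_nonneg_pos)
  obtain k3 where k3: "0 < k3" and ev3: "\<forall>\<^sub>F n in sequentially. \<forall>N. real N \<le> K * real n powr \<zeta> \<longrightarrow> prob (b3 k3 N n) \<le> e"
    using no_small_disc_wide[OF e, of K] K unfolding b3_def by auto
  obtain k4 where k4: "0 < k4" and ev4: "\<forall>\<^sub>F n in sequentially. \<forall>N. real N \<le> k4 * real n powr \<zeta> \<longrightarrow> prob (b3 (8 * A) N n) \<le> e"
    using no_small_disc_narrow[OF e, of "8 * A"] A unfolding b3_def by auto
  obtain \<eta> where \<eta>: "0 < \<eta>" and ev5: "\<forall>\<^sub>F n in sequentially. \<forall>N. real N \<le> K * real n powr \<zeta> \<longrightarrow> prob (b4 (8 * A) \<eta> N n) \<le> e"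
    using no_near_tie[OF e, of K "8 * A"] K A unfolding b4_def by auto
  define \<epsilon> where "\<epsilon> = min (1/2) (\<eta> / (32 * A))"
  have eps: "0 < \<epsilon>" "\<epsilon> \<le> 1/2" using \<eta> A by (auto simp: \<epsilon>_def)
  have eta_eps: "16 * A * \<epsilon> \<le> (1 - \<epsilon>) * \<eta>"
  proof -
    have "\<epsilon> \<le> \<eta> / (32 * A)" by (simp add: \<epsilon>_def)
    then have "16 * A * \<epsilon> \<le> 1/2 * \<eta>" using A by (simp add: field_simps)
    also have "\<dots> \<le> (1 - \<epsilon>) * \<eta>" using eps \<eta> by (intro mult_right_mono) auto
    finally show ?thesis .
  qed
  have ev6: "\<forall>\<^sub>F n in sequentially. prob (b6 \<epsilon> n) \<le> e"
    using no_large_sum[OF e eps(1)] unfolding b6_def .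
  \<comment> \<open>The window is enlarged because triples are needed up to
    \<open>R + 1\<close>.\<close>
  have ev7: "\<forall>\<^sub>F n in sequentially. \<forall>N. real N \<le> (K + 1) * real n powr \<zeta> \<longrightarrow> prob (b5 N n) \<le> e"
    using no_triple[OF e, of "K + 1"] K unfolding b5_def by auto
  define k1 where "k1 = min k4 (k3 / 8)"
  define k2 where "k2 = K + 8 * A + k1"
  have k1: "0 < k1" "k1 \<le> k4" "k1 \<le> k3 / 8" "k1 \<le> k3" using k3 k4 by (auto simp: k1_def)
  have k2: "k1 < k2" "K \<le> k2" "8 * A \<le> k2" "A \<le> k2" using k1 K A by (auto simp: k2_def)
  have c2: "0 < 2 * c" using c_pos by simp
  show ?thesis
  proof (rule exI[of _ k1], rule exI[of _ k2], intro conjI k1(1) k2(1))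
    from ev1 ev3 ev4 ev5 ev6 ev7 delta_le[OF c2, of "8 * A + 1 + \<eta>"]
      delta_slack_less_height[of "8 * A + 1 + \<eta>"] slack_le powr_zeta_ge[of 1] eventually_gt_at_top[of 0]
    show "\<forall>\<^sub>F n in sequentially. \<exists>E\<in>events. 1 - \<epsilon>0 \<le> prob E \<and>
    (\<forall>\<omega>\<in>E. \<forall>\<gamma> l. optimal_walk (\<lambda>i. B i \<omega>) (\<lambda>x. F x \<omega>) n \<gamma> \<longrightarrow> l \<in> \<gamma> ` {0..n} \<longrightarrow>
      (\<forall>x\<in>\<gamma> ` {0..n}. disc l \<omega> \<le> disc x \<omega>) \<longrightarrow>
      (\<forall>i. hit_time \<gamma> l \<le> i \<and> i \<le> n \<longrightarrow> \<gamma> i \<in> {l, l + 1}) \<and>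
      k1 * real n powr \<zeta> \<le> real_of_int \<bar>l\<bar> \<and> real_of_int \<bar>l\<bar> \<le> k2 * real n powr \<zeta> \<and>
      k1 * \<delta> n \<le> disc l \<omega> \<and> disc l \<omega> \<le> k2 * \<delta> n \<and>
      k1 * real n powr \<zeta> \<le> c * real n + action (\<lambda>i. B i \<omega>) (\<lambda>x. F x \<omega>) n \<gamma> \<and>
      c * real n + action (\<lambda>i. B i \<omega>) (\<lambda>x. F x \<omega>) n \<gamma> \<le> k2 * real n powr \<zeta>)"
    proof eventually_elim
      case (elim n)
      define L where "L = real n powr \<zeta>"
      have L: "1 \<le> L" "L = \<delta> n * real n" using elim by (auto simp: L_def delta_mult)
      have d: "0 < \<delta> n" using elim delta_pos by simp
      define R where "R = nat \<lceil>(2 * A / w + 1) * L\<rceil>"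
      define N4 where "N4 = nat \<lfloor>k4 * L\<rfloor>"
      have "0 \<le> 2 * A / w" using A w by simp
      then have pos: "0 < (2 * A / w + 1) * L" using L by (intro mult_pos_pos) auto
      have R: "(2 * A / w + 1) * L \<le> real R" "real R \<le> K * L" "0 < R"
      proof -
        show "(2 * A / w + 1) * L \<le> real R" "0 < R" using pos by (auto simp: R_def)
        have "real R \<le> (2 * A / w + 1) * L + 1" using pos by (simp add: R_def)
        also have "\<dots> \<le> K * L" using L by (simp add: K_def algebra_simps)
        finally show "real R \<le> K * L" .
      qed
      have R1: "real (R + 1) \<le> (K + 1) * L" using R L by (simp add: algebra_simps)
      have N4: "real N4 \<le> k4 * L" using k4 L by (simp add: N4_def)
      have Rbig: "A * (\<delta> n * real n) < (c - (c - w)) * (real R / 2)"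
      proof -
        have "A * L < w * ((2 * A / w + 1) * L / 2)" using w L by (simp add: field_simps)
        also have "\<dots> \<le> w * (real R / 2)" using R w by (intro mult_left_mono) auto
        finally show ?thesis by (simp add: L)
      qed
      define bad where "bad = b1 K1 n \<union> (b2 w {1..int R} \<union> (b2 w {- int R..-1} \<union> (b3 k3 R n \<union>
        (b3 (8 * A) N4 n \<union> (b4 (8 * A) \<eta> R n \<union> (b5 (R + 1) n \<union> b6 \<epsilon> n))))))"
      have bad_event[measurable]: "bad \<in> events"
        unfolding bad_def by (intro sets.Un bad_events finite_atLeastAtMost_int)
      have "prob bad \<le> e + (e + (e + (e + (e + (e + (e + e))))))"
        unfolding bad_def
      proof (intro order_trans[OF measure_Un_le add_mono] sets.Un bad_events finite_atLeastAtMost_int)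
        show "prob (b2 w {1..int R}) \<le> e" "prob (b2 w {- int R..-1}) \<le> e"
          using prob_few_low_sites[of "{1..int R}" w] prob_few_low_sites[of "{- int R..-1}" w] w R
          by (auto simp: b2_def)
        show "prob (b3 k3 R n) \<le> e" "prob (b4 (8 * A) \<eta> R n) \<le> e"
          using elim R by (auto simp: L_def)
        show "prob (b3 (8 * A) N4 n) \<le> e" using elim N4 by (auto simp: L_def)
        show "prob (b5 (R + 1) n) \<le> e" using elim R1 by (auto simp: L_def)
      qed (use elim in auto)
      then have prob_bad: "prob bad \<le> \<epsilon>0" by (simp add: e_def)
      \<comment> \<open>There are countably many sites and times, so the almost sure bounds hold for
        all of them at once and cost no probability.\<close>
      define E where "E = {\<omega>\<in>space M. (\<forall>x. \<bar>F x \<omega>\<bar> \<le> c) \<and> (\<forall>i. B i \<omega> = 1 \<or> B i \<omega> = -1)} - bad"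
      have E[measurable]: "E \<in> events" unfolding E_def by measurable
      have "prob (space M - bad) \<le> prob E"
      proof (rule finite_measure_mono_AE)
        have "AE \<omega> in M. \<forall>x. \<bar>F x \<omega>\<bar> \<le> c" "AE \<omega> in M. \<forall>i. B i \<omega> = 1 \<or> B i \<omega> = -1"
          unfolding AE_all_countable using AE_F_bound AE_B_sign by auto
        then show "AE \<omega> in M. \<omega> \<in> space M - bad \<longrightarrow> \<omega> \<in> E"
          by eventually_elim (auto simp: E_def)
      qed simp
      then have prob_E: "1 - \<epsilon>0 \<le> prob E" using prob_bad by (simp add: prob_compl)
      show ?case
      proof (rule bexI[OF _ E], rule conjI[OF prob_E], intro ballI allI impI)
        fix \<omega> \<gamma> l
        assume \<omega>: "\<omega> \<in> E" and opt: "optimal_walk (\<lambda>i. B i \<omega>) (\<lambda>x. F x \<omega>) n \<gamma>"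
          and l: "l \<in> \<gamma> ` {0..n}" and lmin: "\<forall>x\<in>\<gamma> ` {0..n}. disc l \<omega> \<le> disc x \<omega>"
        have sp: "\<omega> \<in> space M" using \<omega> by (simp add: E_def)
        interpret bp: bounded_potential c "\<lambda>i. B i \<omega>" "\<lambda>x. F x \<omega>"
          by unfold_locales (use \<omega> c_pos in \<open>auto simp: E_def\<close>)
        have "\<omega> \<notin> b1 K1 n" using \<omega> by (simp add: E_def bad_def)
        then obtain j where j: "j < nat \<lceil>L / 2\<rceil>" "disc (2 * int j) \<omega> \<le> K1 * \<delta> n"
          using sp by (force simp: b1_def L_def)
        \<comment> \<open>Rounding up in the index range still leaves \<open>2 * j < L\<close>, so
          the edge is within reach of the competitor.\<close>
        have "real j < L / 2" using j(1) by (simp add: zless_nat_eq_int_zless less_ceiling_iff)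
        then have x0: "real (2 * j) \<le> \<delta> n * real n" using L by simp
        have "L \<le> real n powr 1" unfolding L_def using zeta elim by (intro powr_mono) auto
        then have x0n: "2 * j \<le> n" using \<open>real j < L / 2\<close> by simp
        have right: "real R / 2 \<le> real (card {x\<in>{1..int R}. \<bar>F x \<omega>\<bar> \<le> c - w})"
          and left: "real R / 2 \<le> real (card {x\<in>{- int R..-1}. \<bar>F x \<omega>\<bar> \<le> c - w})"
          using \<omega> sp by (auto simp: E_def bad_def b2_def not_less)
        have tri: "\<not> (c - height n < \<bar>F (p - 1) \<omega>\<bar> \<and> c - height n < \<bar>F p \<omega>\<bar> \<and> c - height n < \<bar>F (p + 1) \<omega>\<bar>)"
          if "\<bar>p\<bar> \<le> int R + 1" for p
        proof -
          have "p \<in> {- int (R + 1)..int (R + 1)}" using that by auto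
          moreover have "\<omega> \<notin> b5 (R + 1) n" using \<omega> by (simp add: E_def bad_def)
          ultimately show ?thesis using sp unfolding b5_def by blast
        qed
        have S: "\<bar>\<Sum>i=s..<t. B (int i) \<omega>\<bar> \<le> \<epsilon> * real (t - s) + slack n" if "s \<le> t" "t \<le> Suc n" for s t
        \<comment> \<open>The event \<open>b6\<close> concerns nonempty intervals only; the empty
          sum is covered by \<open>slack \<ge> 0\<close>.\<close>
        proof (cases "s = t")
          case True
          then show ?thesis by (simp add: slack_def)
        next
          case False
          have "\<omega> \<notin> b6 \<epsilon> n" using \<omega> by (simp add: E_def bad_def)
          moreover have "(s, t) \<in> {..Suc n} \<times> {..Suc n}" using that by simp
          ultimately have "\<not> (fst (s, t) < snd (s, t) \<and> \<epsilon> * real (snd (s, t) - fst (s, t)) + slack n \<le>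
              \<bar>\<Sum>i=fst (s, t)..<snd (s, t). B (int i) \<omega>\<bar>)"
            using sp unfolding b6_def by blast
          then show ?thesis using that False by simp
        qed
        have low: "k3 * \<delta> n \<le> disc x \<omega>" if "\<bar>x\<bar> \<le> int R" for x
        proof -
          have "x \<in> {- int R..int R}" using that by auto
          moreover have "\<omega> \<notin> b3 k3 R n" using \<omega> by (simp add: E_def bad_def)
          ultimately show ?thesis using sp unfolding b3_def by force
        qed
        have far: "8 * A * \<delta> n < disc x \<omega>" if "real_of_int \<bar>x\<bar> \<le> k4 * (\<delta> n * real n)" for x
        proof -
          have "\<bar>x\<bar> \<le> \<lfloor>k4 * L\<rfloor>" using that L by (simp add: le_floor_iff)
          moreover have "0 \<le> k4 * L" using k4 L by simp
          ultimately have "x \<in> {- int N4..int N4}" by (auto simp: N4_def)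
          moreover have "\<omega> \<notin> b3 (8 * A) N4 n" using \<omega> by (simp add: E_def bad_def)
          ultimately show ?thesis using sp unfolding b3_def by force
        qed
        have gap: "\<eta> * \<delta> n < \<bar>disc y \<omega> - disc x \<omega>\<bar>"
          if "\<bar>x\<bar> \<le> int R" "\<bar>y\<bar> \<le> int R" "2 \<le> \<bar>x - y\<bar>" "disc y \<omega> \<le> 8 * A * \<delta> n" for x y
        proof -
          have "(x, y) \<in> {- int R..int R} \<times> {- int R..int R}" using that by auto
          moreover have "\<omega> \<notin> b4 (8 * A) \<eta> R n" using \<omega> by (simp add: E_def bad_def)
          ultimately have "\<not> (2 \<le> \<bar>fst (x, y) - snd (x, y)\<bar> \<and> disc (snd (x, y)) \<omega> \<le> 8 * A * \<delta> n \<and>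
              \<bar>disc (snd (x, y)) \<omega> - disc (fst (x, y)) \<omega>\<bar> \<le> \<eta> * \<delta> n)"
            using sp unfolding b4_def by blast
          then show ?thesis using that(3,4) by (simp add: not_le)
        qed
        have lm: "disc l \<omega> \<le> disc x \<omega>" if "x \<in> \<gamma> ` {0..n}" for x
          using lmin that by blast
        have S': "\<bar>\<Sum>i=s..<t. B (int i) \<omega>\<bar> \<le> \<epsilon> * real (t - s) + slack n"
          if "1 \<le> s" "s \<le> t" "t \<le> Suc n" for s t
          using S that by blast
        have side: "0 < n" "0 \<le> K1" "disc (int (2 * j)) \<omega> \<le> K1 * \<delta> n" "c - w \<le> c" "0 \<le> \<epsilon>"
            "0 \<le> slack n" "slack n \<le> real n / 4" "0 \<le> k3"
            "(8 * A + 1 + \<eta>) * \<delta> n * (slack n + 1) < height n" "(8 * A + 1 + \<eta>) * \<delta> n \<le> 2 * c"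
          using elim(7-11) K1 j(2) w eps(1) k3 by (simp_all add: slack_def)
        note est = bp.optimal_walk_estimates[OF opt l lm side(1) d side(2) x0n x0 side(3) right left side(4)
            Rbig[unfolded A_def] tri S' side(5) eps(2) side(6,7) low side(8) far[unfolded A_def]
            gap[unfolded A_def] \<eta> eta_eps[unfolded A_def] side(9,10)[unfolded A_def], folded A_def]
        have bounds: "\<forall>i. hit_time \<gamma> l \<le> i \<and> i \<le> n \<longrightarrow> \<gamma> i \<in> {l, l + 1}"
            "k4 * (\<delta> n * real n) < real_of_int \<bar>l\<bar>" "\<bar>l\<bar> \<le> int R"
            "k3 * \<delta> n \<le> disc l \<omega>" "disc l \<omega> \<le> 8 * A * \<delta> n"
            "k3 / 8 * (\<delta> n * real n) \<le> c * real n + action (\<lambda>i. B i \<omega>) (\<lambda>x. F x \<omega>) n \<gamma>"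
            "c * real n + action (\<lambda>i. B i \<omega>) (\<lambda>x. F x \<omega>) n \<gamma> \<le> A * (\<delta> n * real n)"
          by (rule est; assumption)+
        have mono: "k1 * L \<le> k4 * L" "k1 * \<delta> n \<le> k3 * \<delta> n" "k1 * L \<le> k3 / 8 * L"
          "K * L \<le> k2 * L" "8 * A * \<delta> n \<le> k2 * \<delta> n" "A * L \<le> k2 * L"
          by (intro mult_right_mono; use k1 k2 L(1) d in linarith)+
        have "real_of_int \<bar>l\<bar> \<le> real R" using bounds(3) by linarith
        then show "(\<forall>i. hit_time \<gamma> l \<le> i \<and> i \<le> n \<longrightarrow> \<gamma> i \<in> {l, l + 1}) \<and>
          k1 * real n powr \<zeta> \<le> real_of_int \<bar>l\<bar> \<and> real_of_int \<bar>l\<bar> \<le> k2 * real n powr \<zeta> \<and>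
          k1 * \<delta> n \<le> disc l \<omega> \<and> disc l \<omega> \<le> k2 * \<delta> n \<and>
          k1 * real n powr \<zeta> \<le> c * real n + action (\<lambda>i. B i \<omega>) (\<lambda>x. F x \<omega>) n \<gamma> \<and>
          c * real n + action (\<lambda>i. B i \<omega>) (\<lambda>x. F x \<omega>) n \<gamma> \<le> k2 * real n powr \<zeta>"
          using bounds mono R
          unfolding L_def[symmetric] L(2)[symmetric] by (intro conjI) (assumption | linarith)+
      qed
    qed
  qed
qed

end

section \<open>Inner probabilities and conclusion\<close>

lemma (in prob_space) lprob_ge:
  assumes "E \<in> events" "E \<subseteq> A"
  shows "prob E \<le> lprob M A"
  unfolding lprob_def
  by (rule cSUP_upper) (use assms in \<open>auto intro!: bdd_aboveI[of _ 1]\<close>)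

lemma (in prob_space) lprob_le_1: "lprob M A \<le> 1"
  unfolding lprob_def by (rule cSUP_least) auto

theorem theorem2p4:
  fixes M :: "'a measure"
    and F :: "int \<Rightarrow> 'a \<Rightarrow> real"
    and B :: "int \<Rightarrow> 'a \<Rightarrow> real"
    and \<rho> :: "real \<Rightarrow> real"
    and c q \<kappa> :: real
    and gam :: "nat \<Rightarrow> 'a \<Rightarrow> nat \<Rightarrow> int"
    and ell :: "nat \<Rightarrow> 'a \<Rightarrow> int"
  assumes "prob_space M"
    and "c > 0" and "q > 0" and "\<kappa> > -1"
    and indep: "prob_space.indep_vars M (\<lambda>_. borel)
                  (\<lambda>k. case k of Inl x \<Rightarrow> F x | Inr i \<Rightarrow> B i) UNIV"
    and F_dist: "\<And>x. distributed M lborel (F x) (\<lambda>t. ennreal (\<rho> t))"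
    and B_rv: "\<And>i. B i \<in> borel_measurable M"
    and B_plus: "\<And>i. prob_space.prob M {\<omega> \<in> space M. B i \<omega> = 1} = 1/2"
    and B_minus: "\<And>i. prob_space.prob M {\<omega> \<in> space M. B i \<omega> = -1} = 1/2"
    and \<rho>_even: "\<And>t. \<rho> (-t) = \<rho> t"
    and \<rho>_cont: "continuous_on {-c<..<c} \<rho>"
    and \<rho>_pos: "\<And>t. t \<in> {-c<..<c} \<Longrightarrow> \<rho> t > 0"
    and \<rho>_zero: "\<And>t. t \<notin> {-c<..<c} \<Longrightarrow> \<rho> t = 0"
    and \<rho>_edge: "((\<lambda>t. \<rho> t / \<bar>c - t\<bar> powr \<kappa>) \<longlongrightarrow> q) (at_left c)"
    and gam_opt: "\<And>n \<omega>. \<omega> \<in> space M \<Longrightarrow>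
                    optimal_walk (\<lambda>i. B i \<omega>) (\<lambda>x. F x \<omega>) n (gam n \<omega>)"
    and ell_range: "\<And>n \<omega>. \<omega> \<in> space M \<Longrightarrow> ell n \<omega> \<in> gam n \<omega> ` {0..n}"
    and ell_min: "\<And>n \<omega> x. \<omega> \<in> space M \<Longrightarrow> x \<in> gam n \<omega> ` {0..n} \<Longrightarrow>
                    discrepancy c (\<lambda>y. F y \<omega>) (ell n \<omega>) \<le> discrepancy c (\<lambda>y. F y \<omega>) x"
  shows "(\<lambda>n. lprob M {\<omega> \<in> space M. \<forall>i. hit_time (gam n \<omega>) (ell n \<omega>) \<le> i \<and> i \<le> n \<longrightarrow>
                  gam n \<omega> i \<in> {ell n \<omega>, ell n \<omega> + 1}}) \<longlonglongrightarrow> 1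
     \<and> (\<forall>\<epsilon>>0. \<exists>k1 k2. 0 < k1 \<and> k1 < k2 \<and>
          (\<forall>\<^sub>F n in sequentially.
             (let \<zeta> = (2 * \<kappa> + 2) / (2 * \<kappa> + 3) in
              lprob M {\<omega> \<in> space M. k1 * real n powr \<zeta> \<le> \<bar>ell n \<omega>\<bar>
                                    \<and> \<bar>ell n \<omega>\<bar> \<le> k2 * real n powr \<zeta>} \<ge> 1 - \<epsilon>
            \<and> lprob M {\<omega> \<in> space M.
                   k1 * real n powr (\<zeta> - 1) \<le> discrepancy c (\<lambda>y. F y \<omega>) (ell n \<omega>)
                 \<and> discrepancy c (\<lambda>y. F y \<omega>) (ell n \<omega>) \<le> k2 * real n powr (\<zeta> - 1)} \<ge> 1 - \<epsilon>
            \<and> lprob M {\<omega> \<in> space M.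
                   k1 * real n powr \<zeta> \<le> c * real n + action (\<lambda>i. B i \<omega>) (\<lambda>x. F x \<omega>) n (gam n \<omega>)
                 \<and> c * real n + action (\<lambda>i. B i \<omega>) (\<lambda>x. F x \<omega>) n (gam n \<omega>) \<le> k2 * real n powr \<zeta>}
                 \<ge> 1 - \<epsilon>)))"
proof -
  interpret sign_field M F B \<rho> c q \<kappa>
    by (intro sign_field.intro sign_field_axioms.intro) (fact+)
  obtain u where "sign_field_edge M F B \<rho> c q \<kappa> u" by (rule ex_sign_field_edge)
  then interpret sign_field_edge M F B \<rho> c q \<kappa> u .
  have \<zeta>: "(2 * \<kappa> + 2) / (2 * \<kappa> + 3) = \<zeta>" by (simp add: \<zeta>_def a_def algebra_simps)
  define stays where "stays n = {\<omega> \<in> space M. \<forall>i. hit_time (gam n \<omega>) (ell n \<omega>) \<le> i \<and> i \<le> n \<longrightarrow>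
                  gam n \<omega> i \<in> {ell n \<omega>, ell n \<omega> + 1}}" for n
  \<comment> \<open>The selections \<open>gam\<close> and \<open>ell\<close> need not be measurable
    in \<open>\<omega>\<close>. Each of the four sets contains the same measurable event from
    \<open>good_event\<close>, which bounds its inner probability.\<close>
  have main: "\<exists>k1 k2. 0 < k1 \<and> k1 < k2 \<and> (\<forall>\<^sub>F n in sequentially. 1 - \<epsilon> \<le> lprob M (stays n) \<and>
      1 - \<epsilon> \<le> lprob M {\<omega> \<in> space M. k1 * real n powr \<zeta> \<le> \<bar>ell n \<omega>\<bar> \<and> \<bar>ell n \<omega>\<bar> \<le> k2 * real n powr \<zeta>} \<and>
      1 - \<epsilon> \<le> lprob M {\<omega> \<in> space M. k1 * real n powr (\<zeta> - 1) \<le> disc (ell n \<omega>) \<omega> \<and>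
         disc (ell n \<omega>) \<omega> \<le> k2 * real n powr (\<zeta> - 1)} \<and>
      1 - \<epsilon> \<le> lprob M {\<omega> \<in> space M.
         k1 * real n powr \<zeta> \<le> c * real n + action (\<lambda>i. B i \<omega>) (\<lambda>x. F x \<omega>) n (gam n \<omega>)
       \<and> c * real n + action (\<lambda>i. B i \<omega>) (\<lambda>x. F x \<omega>) n (gam n \<omega>) \<le> k2 * real n powr \<zeta>})"
    if \<epsilon>: "0 < \<epsilon>" for \<epsilon>
  proof -
    obtain k1 k2 where k: "0 < k1" "k1 < k2" and ev: "\<forall>\<^sub>F n in sequentially. \<exists>E\<in>events. 1 - \<epsilon> \<le> prob E \<and>
      (\<forall>\<omega>\<in>E. \<forall>\<gamma> l. optimal_walk (\<lambda>i. B i \<omega>) (\<lambda>x. F x \<omega>) n \<gamma> \<longrightarrow> l \<in> \<gamma> ` {0..n} \<longrightarrow>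
      (\<forall>x\<in>\<gamma> ` {0..n}. disc l \<omega> \<le> disc x \<omega>) \<longrightarrow>
      (\<forall>i. hit_time \<gamma> l \<le> i \<and> i \<le> n \<longrightarrow> \<gamma> i \<in> {l, l + 1}) \<and>
      k1 * real n powr \<zeta> \<le> real_of_int \<bar>l\<bar> \<and> real_of_int \<bar>l\<bar> \<le> k2 * real n powr \<zeta> \<and>
      k1 * \<delta> n \<le> disc l \<omega> \<and> disc l \<omega> \<le> k2 * \<delta> n \<and>
      k1 * real n powr \<zeta> \<le> c * real n + action (\<lambda>i. B i \<omega>) (\<lambda>x. F x \<omega>) n \<gamma> \<and>
      c * real n + action (\<lambda>i. B i \<omega>) (\<lambda>x. F x \<omega>) n \<gamma> \<le> k2 * real n powr \<zeta>)"
      using good_event[OF \<epsilon>] by blast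
    show ?thesis
    proof (rule exI[of _ k1], rule exI[of _ k2], intro conjI k)
      from ev show "\<forall>\<^sub>F n in sequentially. 1 - \<epsilon> \<le> lprob M (stays n) \<and>
      1 - \<epsilon> \<le> lprob M {\<omega> \<in> space M. k1 * real n powr \<zeta> \<le> \<bar>ell n \<omega>\<bar> \<and> \<bar>ell n \<omega>\<bar> \<le> k2 * real n powr \<zeta>} \<and>
      1 - \<epsilon> \<le> lprob M {\<omega> \<in> space M. k1 * real n powr (\<zeta> - 1) \<le> disc (ell n \<omega>) \<omega> \<and>
         disc (ell n \<omega>) \<omega> \<le> k2 * real n powr (\<zeta> - 1)} \<and>
      1 - \<epsilon> \<le> lprob M {\<omega> \<in> space M.
         k1 * real n powr \<zeta> \<le> c * real n + action (\<lambda>i. B i \<omega>) (\<lambda>x. F x \<omega>) n (gam n \<omega>)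
       \<and> c * real n + action (\<lambda>i. B i \<omega>) (\<lambda>x. F x \<omega>) n (gam n \<omega>) \<le> k2 * real n powr \<zeta>}"
      proof eventually_elim
        case (elim n)
        then obtain E where E: "E \<in> events" "1 - \<epsilon> \<le> prob E" and
          imp: "\<And>\<omega> \<gamma> l. \<omega> \<in> E \<Longrightarrow> optimal_walk (\<lambda>i. B i \<omega>) (\<lambda>x. F x \<omega>) n \<gamma> \<Longrightarrow> l \<in> \<gamma> ` {0..n} \<Longrightarrow>
            (\<forall>x\<in>\<gamma> ` {0..n}. disc l \<omega> \<le> disc x \<omega>) \<Longrightarrow>
            (\<forall>i. hit_time \<gamma> l \<le> i \<and> i \<le> n \<longrightarrow> \<gamma> i \<in> {l, l + 1}) \<and>
            k1 * real n powr \<zeta> \<le> real_of_int \<bar>l\<bar> \<and> real_of_int \<bar>l\<bar> \<le> k2 * real n powr \<zeta> \<and>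
            k1 * \<delta> n \<le> disc l \<omega> \<and> disc l \<omega> \<le> k2 * \<delta> n \<and>
            k1 * real n powr \<zeta> \<le> c * real n + action (\<lambda>i. B i \<omega>) (\<lambda>x. F x \<omega>) n \<gamma> \<and>
            c * real n + action (\<lambda>i. B i \<omega>) (\<lambda>x. F x \<omega>) n \<gamma> \<le> k2 * real n powr \<zeta>"
          by blast
        have sp: "\<omega> \<in> space M" if "\<omega> \<in> E" for \<omega> using that sets.sets_into_space[OF E(1)] by blast
        note imp' = imp[OF _ gam_opt[OF sp] ell_range[OF sp] ballI[OF ell_min[OF sp]], unfolded \<delta>_def]
        show ?case
          by (intro conjI order_trans[OF E(2) lprob_ge[OF E(1)]] subsetI CollectI sp)
             (use imp' in \<open>auto simp: stays_def sp\<close>)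
      qed
    qed
  qed
  have "(\<lambda>n. lprob M (stays n)) \<longlonglongrightarrow> 1"
  proof (rule order_tendstoI)
    fix y :: real assume "y < 1"
    \<comment> \<open>Halving leaves a strict margin above \<open>y\<close>.\<close>
    then have "0 < (1 - y) / 2" by simp
    from main[OF this] have "\<forall>\<^sub>F n in sequentially. 1 - (1 - y) / 2 \<le> lprob M (stays n)"
      by (elim exE conjE) (erule eventually_mono, blast)
    then show "\<forall>\<^sub>F n in sequentially. y < lprob M (stays n)"
      by eventually_elim (use \<open>y < 1\<close> in \<open>auto simp: field_simps\<close>)
  next
    fix y :: real assume "1 < y"
    then show "\<forall>\<^sub>F n in sequentially. lprob M (stays n) < y"
      using lprob_le_1 by (intro always_eventually allI) (rule order.strict_trans1)
  qed
  moreover have "\<exists>k1 k2. 0 < k1 \<and> k1 < k2 \<and> (\<forall>\<^sub>F n in sequentially.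
      1 - \<epsilon> \<le> lprob M {\<omega> \<in> space M. k1 * real n powr \<zeta> \<le> \<bar>ell n \<omega>\<bar> \<and> \<bar>ell n \<omega>\<bar> \<le> k2 * real n powr \<zeta>} \<and>
      1 - \<epsilon> \<le> lprob M {\<omega> \<in> space M. k1 * real n powr (\<zeta> - 1) \<le> disc (ell n \<omega>) \<omega> \<and>
         disc (ell n \<omega>) \<omega> \<le> k2 * real n powr (\<zeta> - 1)} \<and>
      1 - \<epsilon> \<le> lprob M {\<omega> \<in> space M.
         k1 * real n powr \<zeta> \<le> c * real n + action (\<lambda>i. B i \<omega>) (\<lambda>x. F x \<omega>) n (gam n \<omega>)
       \<and> c * real n + action (\<lambda>i. B i \<omega>) (\<lambda>x. F x \<omega>) n (gam n \<omega>) \<le> k2 * real n powr \<zeta>})"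
    if \<epsilon>: "0 < \<epsilon>" for \<epsilon>
  proof -
    from main[OF \<epsilon>] obtain k1 k2 where "0 < k1" "k1 < k2" and ev: "\<forall>\<^sub>F n in sequentially. 1 - \<epsilon> \<le> lprob M (stays n) \<and>
      1 - \<epsilon> \<le> lprob M {\<omega> \<in> space M. k1 * real n powr \<zeta> \<le> \<bar>ell n \<omega>\<bar> \<and> \<bar>ell n \<omega>\<bar> \<le> k2 * real n powr \<zeta>} \<and>
      1 - \<epsilon> \<le> lprob M {\<omega> \<in> space M. k1 * real n powr (\<zeta> - 1) \<le> disc (ell n \<omega>) \<omega> \<and>
         disc (ell n \<omega>) \<omega> \<le> k2 * real n powr (\<zeta> - 1)} \<and>
      1 - \<epsilon> \<le> lprob M {\<omega> \<in> space M.
         k1 * real n powr \<zeta> \<le> c * real n + action (\<lambda>i. B i \<omega>) (\<lambda>x. F x \<omega>) n (gam n \<omega>)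
       \<and> c * real n + action (\<lambda>i. B i \<omega>) (\<lambda>x. F x \<omega>) n (gam n \<omega>) \<le> k2 * real n powr \<zeta>}"
      by blast
    show ?thesis
      by (rule exI[of _ k1], rule exI[of _ k2], intro conjI \<open>0 < k1\<close> \<open>k1 < k2\<close>)
         (rule eventually_mono[OF ev], elim conjE, intro conjI)
  qed
  ultimately show ?thesis unfolding \<zeta> Let_def stays_def by blast
qed

end
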